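(* Let $(X,\|\cdot\|)$ be a Banach space and let $I\in C^1(X,\mathbb{R})$ be a functional of the form $I(u)=A(u)-B(u)$ for all $u\in X$, satisfying conditions (A) and ($\Psi$) stated in the context, with $\{\psi_n\}\subset C(X,X)$ the sequence of mappings in ($\Psi$). Assume $X=Y\oplus Z$ with $\dim Y<\infty$ and assume that there exists $\rho>0$ such that $$\inf_{u\in Z}I(u)>\max_{u\in M_0}I(u)\qquad\text{and}\qquad \lim_{n\to\infty}\max_{u\in M_0}\|\psi_n(u)-u\|=0,$$ where $M_0:=\{u\in Y:\|u\|=\rho\}$. Define $$c:=\inf_{\gamma\in\Gamma}\max_{u\in\gamma(M)}I(u),\quad \Gamma:=\{\gamma\in C(M,X):\gamma_{|M_0}=\mathrm{id}\},\quad M:=\{u\in Y:\|u\|\le\rho\}.$$ Then there exists a sequence $\{w_n\}\subset X$ such that $$I(w_n)\to c,\qquad I'(w_n)\to 0\ \text{in } X',\qquad \sup_n A(w_n)<\infty.$$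
   Context: $X'$ denotes the dual space of $X$, $C(S,T)$ is the set of continuous maps from $S$ to $T$, and $A,B:X\to\mathbb{R}$ are functions. $X=Y\oplus Z$ means a topological direct sum of closed linear subspaces. For $l\in\mathbb{R}$ put $A^{l}:=\{u\in X:A(u)\le l\}$, and $\mathrm{dist}(u,A^{l}):=\inf_{h\in A^{l}}\|u-h\|$. Condition (A): $A$ is nonnegative and for all $l_2>l_1>0$ there exists $\delta_{l_1,l_2}>0$ such that for all $u\in X$, $\mathrm{dist}(u,A^{l_1})\le\delta_{l_1,l_2}$ implies $u\in A^{l_2}$. Condition ($\Psi$): there exists a sequence of mappings $\{\psi_n\}\subset C(X,X)$ such that for every $n$ there exist $\alpha_n>\beta_n>0$ satisfying ($\Psi$1) $A(u)\ge\alpha_n A(\psi_n(u))$ and $B(u)\le\beta_n B(\psi_n(u))$ for all $u\in X$; ($\Psi$2) $\lim_{n\to\infty}\alpha_n=\lim_{n\to\infty}\beta_n=1$ and $\liminf_{n\to\infty}\dfrac{|1-\beta_n|}{\alpha_n-\beta_n}<\infty$. *)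

theory Defs
  imports "HOL-Analysis.Analysis"
begin

text \<open>Infima and suprema of real quantities are taken in the extended reals (or extended nonnegative
  reals), so that they carry the usual meaning also for empty or unbounded index sets. Each maximum
  in the theorem is that of a continuous function over a compact set, hence equals the supremum.\<close>

definition sublevel :: "('a \<Rightarrow> real) \<Rightarrow> real \<Rightarrow> 'a set" where
  "sublevel A l = {u. A u \<le> l}"

text \<open>Unlike \<open>infdist\<close>, which is \<open>0\<close> for the empty set, this is \<open>\<infinity>\<close> if \<open>S\<close> is empty;
  sublevel sets of \<open>A\<close> may well be empty.\<close>

definition edist_set :: "'a::real_normed_vector \<Rightarrow> 'a set \<Rightarrow> ereal" where
  "edist_set u S = (INF h\<in>S. ereal (norm (u - h)))"

definition condition_A :: "('a::real_normed_vector \<Rightarrow> real) \<Rightarrow> bool" where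
  "condition_A A \<longleftrightarrow>
     (\<forall>u. 0 \<le> A u) \<and>
     (\<forall>l1 l2. 0 < l1 \<and> l1 < l2 \<longrightarrow>
        (\<exists>\<delta>>0. \<forall>u. edist_set u (sublevel A l1) \<le> ereal \<delta> \<longrightarrow> u \<in> sublevel A l2))"

text \<open>The sequence \<open>\<psi>\<close> is a parameter, since the theorem refers to it again.\<close>

definition condition_Psi ::
  "('a::real_normed_vector \<Rightarrow> real) \<Rightarrow> ('a \<Rightarrow> real) \<Rightarrow> (nat \<Rightarrow> 'a \<Rightarrow> 'a) \<Rightarrow> bool" where
  "condition_Psi A B \<psi> \<longleftrightarrow>
     (\<forall>n. continuous_on UNIV (\<psi> n)) \<and>
     (\<exists>\<alpha> \<beta> :: nat \<Rightarrow> real.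
        (\<forall>n. \<alpha> n > \<beta> n \<and> \<beta> n > 0) \<and>
        (\<forall>n u. A u \<ge> \<alpha> n * A (\<psi> n u) \<and> B u \<le> \<beta> n * B (\<psi> n u)) \<and>
        \<alpha> \<longlonglongrightarrow> 1 \<and> \<beta> \<longlonglongrightarrow> 1 \<and>
        liminf (\<lambda>n. ereal (\<bar>1 - \<beta> n\<bar> / (\<alpha> n - \<beta> n))) < \<infinity>)"

text \<open>Bijectivity of addition on \<open>Y \<times> Z\<close> is the algebraic direct sum; continuity of the inverse
  is continuity of the two projections.\<close>

definition topological_direct_sum :: "'a::real_normed_vector set \<Rightarrow> 'a set \<Rightarrow> bool" where
  "topological_direct_sum Y Z \<longleftrightarrow>
     subspace Y \<and> closed Y \<and> subspace Z \<and> closed Z \<and>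
     (\<exists>p. homeomorphism (Y \<times> Z) UNIV (\<lambda>(y, z). y + z) p)"

text \<open>The library's \<open>dim\<close> is natural-number valued and so cannot express finiteness of the
  dimension.\<close>

definition finite_dim_subspace :: "'a::real_vector set \<Rightarrow> bool" where
  "finite_dim_subspace Y \<longleftrightarrow> subspace Y \<and> (\<exists>E. finite E \<and> span E = Y)"

definition M_ball :: "'a::real_normed_vector set \<Rightarrow> real \<Rightarrow> 'a set" where
  "M_ball Y \<rho> = {u \<in> Y. norm u \<le> \<rho>}"

definition M_sphere :: "'a::real_normed_vector set \<Rightarrow> real \<Rightarrow> 'a set" where
  "M_sphere Y \<rho> = {u \<in> Y. norm u = \<rho>}"

text \<open>Members are total functions whose values outside \<open>M_ball Y \<rho>\<close> are irrelevant.\<close>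

definition Gamma_maps :: "'a::real_normed_vector set \<Rightarrow> real \<Rightarrow> ('a \<Rightarrow> 'a) set" where
  "Gamma_maps Y \<rho> =
     {\<gamma>. continuous_on (M_ball Y \<rho>) \<gamma> \<and> (\<forall>u\<in>M_sphere Y \<rho>. \<gamma> u = u)}"

definition minimax_level ::
  "('a::real_normed_vector \<Rightarrow> real) \<Rightarrow> 'a set \<Rightarrow> real \<Rightarrow> ereal" where
  "minimax_level I Y \<rho> =
     (INF \<gamma>\<in>Gamma_maps Y \<rho>. SUP u\<in>\<gamma> ` M_ball Y \<rho>. ereal (I u))"

end

theory Submission imports Defs "HOL-Homology.Homology" begin

text \<open>
The value \<open>c\<close> is a minimax level, so almost optimal maps should pass near almost critical points. The
difficulty is to bound \<open>A\<close> at these points. The maps \<open>\<psi> n\<close> make this possible.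
Choose \<open>\<gamma>\<close> with \<open>I \<le> c + (\<alpha> n - \<beta> n)\<close> along its image and replace it by \<open>\<psi> n \<circ> \<gamma>\<close>. Applying \<open>\<psi> n\<close> hardly raises the level (\<open>level_of_rescaled\<close>), but it lowers the level
markedly where \<open>A\<close> is large. So if \<open>\<psi> n (\<gamma> v)\<close> is still at level \<open>c\<close> or above, then \<open>A\<close>
is bounded there by a constant \<open>K\<close> (\<open>rescaled_bound\<close>); the finiteness of the lower limit in
condition (\<open>\<Psi>\<close>) makes \<open>K\<close> independent of \<open>n\<close>, for infinitely many \<open>n\<close>. Since \<open>\<psi> n\<close> is close to
the identity on the sphere, where \<open>I\<close> stays below \<open>c\<close>, a narrow collar restores the boundary values
without reaching the level \<open>c\<close> (\<open>collared_path\<close>).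

The resulting map \<open>\<eta>\<close> is admissible and almost optimal, and \<open>A \<le> K\<close> at all of its points of level at
least \<open>c\<close>. The lemma \<open>constrained_minimax_principle\<close> then gives an almost critical \<open>w\<close> at a level
between \<open>c\<close> and \<open>c + e\<close>, with \<open>e\<close> arbitrarily small, and a point of the image of \<open>\<eta>\<close> that is at
least as high as \<open>w\<close> and so close to \<open>w\<close> that condition (A) for the levels \<open>K\<close> and \<open>K + 1\<close> gives
\<open>A w \<le> K + 1\<close>. Instead of a deformation along a pseudo-gradient flow, the principle uses Ekeland's
variational principle on the space of maps nowhere higher than \<open>\<eta>\<close>, for which
a single descent step suffices.

All of this presupposes that \<open>c\<close> is finite and above the values on the sphere. This is the
topological part: every admissible map meets \<open>Z\<close> (\<open>linking_intersection\<close>), because the identity of a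
sphere is not homotopic to a constant.
\<close>

section \<open>Ekeland's variational principle\<close>

text \<open>The order \<open>y \<preceq> x \<longleftrightarrow> f y + \<kappa> * dist x y \<le> f x\<close> has closed lower sections \<open>T x\<close>, and a step to an almost
optimal point of the current section makes the next section small. The sections therefore shrink to
a single point, which no other point of \<open>S\<close> precedes.\<close>
lemma ekeland_variational_principle:
  fixes f :: "'x::complete_space \<Rightarrow> real"
  assumes x0: "x0 \<in> S" and bdd: "\<And>x. x \<in> S \<Longrightarrow> m \<le> f x"
    and lsc: "\<And>a. closed {x \<in> S. f x \<le> a}" and \<kappa>: "\<kappa> > 0"
  obtains x where "x \<in> S" "f x + \<kappa> * dist x0 x \<le> f x0"
    "\<And>y. y \<in> S \<Longrightarrow> y \<noteq> x \<Longrightarrow> f x < f y + \<kappa> * dist x y"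
proof -
  define T where "T x = {y \<in> S. f y + \<kappa> * dist x y \<le> f x}" for x
  have T_refl: "x \<in> T x" if "x \<in> S" for x
    using that by (simp add: T_def)
  have T_trans: "T y \<subseteq> T x" if "y \<in> T x" for x y
  proof
    fix z assume z: "z \<in> T y"
    have "\<kappa> * dist x z \<le> \<kappa> * dist x y + \<kappa> * dist y z"
      using \<kappa> by (simp add: dist_triangle flip: distrib_left)
    with z that show "z \<in> T x" by (auto simp: T_def)
  qed
  have T_closed: "closed (T x)" for x
    unfolding closed_sequential_limits
  proof (intro allI impI, elim conjE)
    fix y l assume y: "\<forall>n. y n \<in> T x" and lim: "y \<longlonglongrightarrow> l"
    have le: "l \<in> {z \<in> S. f z \<le> f x - \<kappa> * dist x l + e}" if "e > 0" for e
    proof (rule Lim_in_closed_set[OF lsc _ _ lim])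
      have "(\<lambda>n. f x - \<kappa> * dist x (y n)) \<longlonglongrightarrow> f x - \<kappa> * dist x l"
        by (intro tendsto_intros lim)
      then have "\<forall>\<^sub>F n in sequentially. f x - \<kappa> * dist x (y n) < f x - \<kappa> * dist x l + e"
        using that by (intro order_tendstoD(2)) auto
      then show "\<forall>\<^sub>F n in sequentially. y n \<in> {z \<in> S. f z \<le> f x - \<kappa> * dist x l + e}"
      proof eventually_elim
        case (elim n)
        then show ?case using y[rule_format, of n] by (auto simp: T_def)
      qed
    qed auto
    have "f l \<le> f x - \<kappa> * dist x l"
      by (rule field_le_epsilon) (use le in auto)
    then show "l \<in> T x" using le[of 1] by (auto simp: T_def)
  qed
  have step: "\<exists>y \<in> T x. \<forall>z \<in> T x. f y \<le> f z + e" if "x \<in> S" "e > 0" for x and e :: real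
  proof -
    have bd: "bdd_below (f ` T x)" using bdd by (auto simp: T_def bdd_below_def)
    have "Inf (f ` T x) < Inf (f ` T x) + e" using that by simp
    then obtain y where "y \<in> T x" "f y < Inf (f ` T x) + e"
      using T_refl[OF \<open>x \<in> S\<close>] cInf_lessD[of "f ` T x"] by blast
    moreover have "Inf (f ` T x) \<le> f z" if "z \<in> T x" for z
      using that bd by (simp add: cINF_lower)
    ultimately show ?thesis by force
  qed
  have "\<exists>s. \<forall>n. (s n \<in> S \<and> (n = 0 \<longrightarrow> s n = x0)) \<and>
      (s (Suc n) \<in> T (s n) \<and> (\<forall>z \<in> T (s n). f (s (Suc n)) \<le> f z + (1/2)^n))"
  proof (rule dependent_nat_choice)
    show "\<exists>x. x \<in> S \<and> (0 = (0::nat) \<longrightarrow> x = x0)" using x0 by auto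
    fix x n assume "x \<in> S \<and> (n = (0::nat) \<longrightarrow> x = x0)"
    with step[of x "(1/2)^n"] obtain y where "y \<in> T x" "\<forall>z \<in> T x. f y \<le> f z + (1/2)^n"
      by auto
    then show "\<exists>y. (y \<in> S \<and> (Suc n = 0 \<longrightarrow> y = x0)) \<and> y \<in> T x \<and> (\<forall>z \<in> T x. f y \<le> f z + (1/2)^n)"
      by (auto simp: T_def)
  qed
  then obtain s where s: "\<And>n. s n \<in> S" "s 0 = x0" "\<And>n. s (Suc n) \<in> T (s n)"
    and small: "\<And>n z. z \<in> T (s n) \<Longrightarrow> f (s (Suc n)) \<le> f z + (1/2)^n" by metis
  have mono: "T (s n) \<subseteq> T (s k)" if "k \<le> n" for k n
    using lift_Suc_antimono_le[of "\<lambda>n. T (s n)" k n] T_trans s(3) that by blast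
  have later: "s n \<in> T (s k)" if "k \<le> n" for k n
    using mono[OF that] T_refl s(1) by blast
  have near: "dist (s (Suc n)) z \<le> (1/2)^n / \<kappa>" if "z \<in> T (s (Suc n))" for n z
  proof -
    have "z \<in> T (s n)" using that mono[of n "Suc n"] by auto
    then have "\<kappa> * dist (s (Suc n)) z \<le> (1/2)^n"
      using small[of z n] that by (auto simp: T_def)
    then show ?thesis using \<kappa> by (simp add: field_simps)
  qed
  have lim0: "(\<lambda>n. (1/2)^n / \<kappa>) \<longlonglongrightarrow> 0"
    by (rule tendsto_divide_zero) (simp add: LIMSEQ_power_zero)
  have "Cauchy s"
  proof (rule metric_CauchyI)
    fix e :: real assume "e > 0"
    then obtain n where n: "(1/2)^n / \<kappa> < e / 2"
      using order_tendstoD(2)[OF lim0, of "e/2"] by (auto simp: eventually_sequentially)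
    have "dist (s a) (s b) < e" if "a \<ge> Suc n" "b \<ge> Suc n" for a b
    proof -
      have "dist (s a) (s b) \<le> dist (s (Suc n)) (s a) + dist (s (Suc n)) (s b)"
        by (rule dist_triangle3)
      then show ?thesis using near[OF later[OF that(1)]] near[OF later[OF that(2)]] n by linarith
    qed
    then show "\<exists>M. \<forall>m\<ge>M. \<forall>n\<ge>M. dist (s m) (s n) < e" by blast
  qed
  then obtain x where x: "s \<longlonglongrightarrow> x" using Cauchy_convergent convergent_def by blast
  have xT: "x \<in> T (s n)" for n
  proof (rule Lim_in_closed_set[OF T_closed _ _ x])
    show "\<forall>\<^sub>F k in sequentially. s k \<in> T (s n)"
      using later unfolding eventually_sequentially by blast
  qed auto
  show thesis
  proof
    show xS: "x \<in> S" and "f x + \<kappa> * dist x0 x \<le> f x0" using xT[of 0] s(2) by (auto simp: T_def)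
    fix y assume y: "y \<in> S" "y \<noteq> x"
    show "f x < f y + \<kappa> * dist x y"
    proof (rule ccontr)
      assume "\<not> ?thesis"
      then have "y \<in> T x" using y by (auto simp: T_def)
      then have yT: "y \<in> T (s n)" for n using T_trans xT by blast
      have "(\<lambda>n. s (Suc n)) \<longlonglongrightarrow> y"
        by (rule metric_tendsto_imp_tendsto[OF lim0])
          (use near[OF yT] \<kappa> in \<open>auto intro!: always_eventually\<close>)
      then have "s \<longlonglongrightarrow> y" using LIMSEQ_imp_Suc by blast
      with x y show False using LIMSEQ_unique by blast
    qed
  qed
qed

section \<open>A minimax principle under a pointwise constraint\<close>

text \<open>Only one of the two points has to lie in the compact set. This matters in infinite dimensions, where
a compact set has no compact neighbourhood.\<close>
lemma uniformly_continuous_near_compact: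
  fixes g :: "'a::metric_space \<Rightarrow> 'b::metric_space"
  assumes "compact K" "continuous_on UNIV g" "e > 0"
  obtains d where "d > 0" "\<And>x y. x \<in> K \<Longrightarrow> dist x y < d \<Longrightarrow> dist (g x) (g y) < e"
proof -
  let ?\<G> = "(\<lambda>x. g -` ball (g x) (e/2)) ` K"
  obtain d where d: "d > 0" "\<And>x. x \<in> K \<Longrightarrow> \<exists>G \<in> ?\<G>. ball x d \<subseteq> G"
  proof (rule Heine_Borel_lemma[OF \<open>compact K\<close>, of ?\<G>])
    show "K \<subseteq> \<Union>?\<G>" using \<open>e > 0\<close> by auto
    show "open G" if "G \<in> ?\<G>" for G
      using that assms(2) by (auto simp: continuous_on_eq_continuous_at intro!: continuous_open_vimage)
  qed blast
  show thesis
  proof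
    fix x y assume "x \<in> K" "dist x y < d"
    with d obtain z where z: "ball x d \<subseteq> g -` ball (g z) (e/2)" by blast
    have "x \<in> ball x d" "y \<in> ball x d" using d(1) \<open>dist x y < d\<close> by auto
    with z have "x \<in> g -` ball (g z) (e/2)" "y \<in> g -` ball (g z) (e/2)" by blast+
    then have "dist (g z) (g x) < e/2" "dist (g z) (g y) < e/2" by simp_all
    then show "dist (g x) (g y) < e" by (metis dist_commute dist_triangle_half_r)
  qed (rule d)
qed

text \<open>A pseudo-gradient field along a compact set of parameters. Near each point of \<open>K\<close> one fixed vector
is a direction of descent, since evaluation at a vector is continuous in the functional. Finitely
many such vectors are averaged with bump functions. Dividing by \<open>max (s x) b\<close> instead of the total
weight \<open>s x\<close> makes the field fade out continuously away from \<open>K\<close>, and \<open>\<phi>\<close> records how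
much of it is left.\<close>
lemma descent_field:
  fixes G :: "'m::metric_space \<Rightarrow> 'a::real_normed_vector \<Rightarrow>\<^sub>L real"
  assumes K: "compact K" "K \<subseteq> M" and G: "continuous_on M G"
    and N: "closed N" "K \<inter> N = {}" and \<epsilon>: "\<epsilon> \<ge> 0" "\<And>u. u \<in> K \<Longrightarrow> \<epsilon> < norm (G u)"
  obtains V \<phi> where "continuous_on M V" "continuous_on M \<phi>"
    "\<And>u. 0 \<le> \<phi> u" "\<And>u. \<phi> u \<le> (1::real)" "\<And>u. u \<in> K \<Longrightarrow> \<phi> u = 1" "\<And>u. u \<in> N \<Longrightarrow> \<phi> u = 0"
    "\<And>u. norm (V u) \<le> \<phi> u" "\<And>u. u \<in> M \<Longrightarrow> G u (V u) \<le> - \<epsilon> * \<phi> u"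
proof -
  have loc: "\<exists>v r. norm v \<le> 1 \<and> r > 0 \<and> ball u r \<inter> N = {} \<and> (\<forall>x \<in> M \<inter> ball u r. G x v < - \<epsilon>)"
    if u: "u \<in> K" for u
  proof -
    \<comment> \<open>The operator norm exceeds \<open>\<epsilon>\<close>, so some vector witnesses this; the right multiple of it points downhill.\<close>
    have "\<exists>z. \<epsilon> * norm z < norm (G u z)"
      using norm_blinfun_bound[of \<epsilon> "G u"] \<epsilon>(1) \<epsilon>(2)[OF u] by (meson not_le)
    then obtain z where z: "\<epsilon> * norm z < \<bar>G u z\<bar>" by auto
    define v where "v = (- sgn (G u z) / norm z) *\<^sub>R z"
    have z0: "z \<noteq> 0" using z by auto
    have v1: "norm v \<le> 1" by (simp add: v_def abs_sgn_eq)
    have "G u v = - (\<bar>G u z\<bar> / norm z)"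
      by (simp add: v_def blinfun.scaleR_right blinfun.minus_right abs_sgn)
    moreover have "\<epsilon> < \<bar>G u z\<bar> / norm z" using z z0 by (simp add: field_simps)
    ultimately have v2: "G u v < - \<epsilon>" by linarith
    have "continuous_on M (\<lambda>x. G x v)" by (intro continuous_intros G)
    then have "open {..< - \<epsilon>} \<longrightarrow> (\<exists>A. open A \<and> A \<inter> M = (\<lambda>x. G x v) -` {..< -\<epsilon>} \<inter> M)"
      by (simp add: continuous_on_open_invariant)
    then obtain A where A: "open A" "A \<inter> M = (\<lambda>x. G x v) -` {..< -\<epsilon>} \<inter> M" by auto
    have "u \<in> A \<inter> - N" "open (A \<inter> - N)" using A v2 u K N by auto
    then obtain r where r: "r > 0" "ball u r \<subseteq> A \<inter> - N" by (meson openE)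
    have "G x v < - \<epsilon>" if "x \<in> M \<inter> ball u r" for x
      using that A(2) r(2) by blast
    with v1 r show ?thesis by blast
  qed
  then obtain v r where v: "\<And>u. u \<in> K \<Longrightarrow> norm (v u) \<le> 1" and r: "\<And>u. u \<in> K \<Longrightarrow> r u > 0"
    "\<And>u. u \<in> K \<Longrightarrow> ball u (r u) \<inter> N = {}"
    and vG: "\<And>u x. u \<in> K \<Longrightarrow> x \<in> M \<Longrightarrow> x \<in> ball u (r u) \<Longrightarrow> G x (v u) < - \<epsilon>"
    by (metis IntI)
  obtain F where F: "F \<subseteq> K" "finite F" "K \<subseteq> (\<Union>u\<in>F. ball u (r u))"
  proof (rule compactE_image[OF K(1), of K "\<lambda>u. ball u (r u)"])
    show "K \<subseteq> (\<Union>u\<in>K. ball u (r u))" using r(1) by force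
  qed (auto intro: that)
  define \<theta> where "\<theta> u x = max 0 (r u - dist u x)" for u x
  define s where "s x = (\<Sum>u\<in>F. \<theta> u x)" for x
  define W where "W x = (\<Sum>u\<in>F. \<theta> u x *\<^sub>R v u)" for x
  have \<theta>0: "\<theta> u x \<ge> 0" for u x by (simp add: \<theta>_def)
  have s0: "s x \<ge> 0" for x by (simp add: s_def \<theta>0 sum_nonneg)
  have cont_s: "continuous_on T s" for T unfolding s_def \<theta>_def by (intro continuous_intros)
  have cont_W: "continuous_on T W" for T unfolding W_def \<theta>_def by (intro continuous_intros)
  have spos: "s x > 0" if xK: "x \<in> K" for x
  proof -
    obtain u where u: "u \<in> F" "x \<in> ball u (r u)" using F(3) xK by auto
    then have "\<theta> u x > 0" by (simp add: \<theta>_def)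
    then show ?thesis unfolding s_def using u \<theta>0 F(2) by (intro sum_pos2[of F u]) auto
  qed
  obtain b where b: "b > 0" "\<And>x. x \<in> K \<Longrightarrow> b \<le> s x"
  proof (cases "K = {}")
    case True then show thesis using that[of 1] by auto
  next
    case False
    then obtain y where "y \<in> K" "\<forall>x\<in>K. s y \<le> s x"
      using continuous_attains_inf[OF K(1) _ cont_s] by blast
    then show thesis using that[of "s y"] spos by auto
  qed
  have maxpos: "max (s x) b > 0" for x using b(1) by auto
  have normW: "norm (W x) \<le> s x" for x
    unfolding W_def s_def
  proof (rule sum_norm_le)
    fix u assume "u \<in> F"
    then have "norm (v u) \<le> 1" using F v by auto
    then show "norm (\<theta> u x *\<^sub>R v u) \<le> \<theta> u x" using \<theta>0[of u x] by (simp add: mult_left_le)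
  qed
  have GW: "G x (W x) \<le> - \<epsilon> * s x" if "x \<in> M" for x
  proof -
    have "G x (W x) = (\<Sum>u\<in>F. \<theta> u x * G x (v u))"
      by (simp add: W_def blinfun.sum_right blinfun.scaleR_right)
    also have "\<dots> \<le> (\<Sum>u\<in>F. \<theta> u x * (- \<epsilon>))"
    proof (rule sum_mono)
      fix u assume u: "u \<in> F"
      show "\<theta> u x * G x (v u) \<le> \<theta> u x * (- \<epsilon>)"
      proof (cases "x \<in> ball u (r u)")
        case True
        then have "G x (v u) \<le> - \<epsilon>" using vG[of u x] F u that by force
        then show ?thesis using \<theta>0 by (rule mult_left_mono)
      next
        case False
        then show ?thesis by (simp add: \<theta>_def)
      qed
    qed
    also have "\<dots> = - \<epsilon> * s x" by (simp add: s_def sum_distrib_left sum_negf mult.commute)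
    finally show ?thesis .
  qed
  show thesis
  proof (rule that[of "\<lambda>x. (1 / max (s x) b) *\<^sub>R W x" "\<lambda>x. s x / max (s x) b"])
    show "continuous_on M (\<lambda>x. (1 / max (s x) b) *\<^sub>R W x)"
      using maxpos by (intro continuous_intros cont_s cont_W) (metis less_irrefl)
    show "continuous_on M (\<lambda>x. s x / max (s x) b)"
      using maxpos by (intro continuous_intros cont_s) (metis less_irrefl)
    fix u
    show "0 \<le> s u / max (s u) b" "s u / max (s u) b \<le> 1" using s0[of u] maxpos[of u] by auto
    show "s u / max (s u) b = 1" if "u \<in> K" using b(2)[OF that] b(1) by (simp add: max_absorb1)
    show "s u / max (s u) b = 0" if "u \<in> N"
    proof -
      have "\<theta> w u = 0" if w: "w \<in> F" for w
      proof -
        have "u \<notin> ball w (r w)" using r(2)[of w] F w \<open>u \<in> N\<close> by blast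
        then show ?thesis by (simp add: \<theta>_def)
      qed
      then show ?thesis by (simp add: s_def)
    qed
    show "norm ((1 / max (s u) b) *\<^sub>R W u) \<le> s u / max (s u) b"
      using normW[of u] maxpos[of u] by (simp add: divide_right_mono)
    show "G u ((1 / max (s u) b) *\<^sub>R W u) \<le> - \<epsilon> * (s u / max (s u) b)" if "u \<in> M"
      using divide_right_mono[OF GW[OF that], of "max (s u) b"] maxpos[of u]
      by (simp add: blinfun.scaleR_right less_imp_le)
  qed
qed


text \<open>Moving every value \<open>f u\<close> a short way along the descent field of the set \<open>K\<close> where \<open>I \<circ> f\<close>
attains \<open>m\<close> raises \<open>I\<close> nowhere. Where the field has weight at least \<open>1/2\<close>, the loss is proportional
to the step length. Elsewhere \<open>I \<circ> f\<close> already stays below \<open>m\<close> by a fixed \<open>\<tau>\<close>, and the step is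
chosen so short that the promised loss does not exceed \<open>\<tau>\<close>.\<close>
lemma one_step_decrease:
  fixes I :: "'a::real_normed_vector \<Rightarrow> real" and I' :: "'a \<Rightarrow> 'a \<Rightarrow>\<^sub>L real"
    and f :: "'m::metric_space \<Rightarrow> 'a"
  assumes deriv: "\<And>u. (I has_derivative I' u) (at u)" and cont: "continuous_on UNIV I'"
    and M: "compact M" and f: "continuous_on M f"
    and N: "closed N" "\<And>u. u \<in> M \<inter> N \<Longrightarrow> I (f u) < m"
    and m: "\<And>u. u \<in> M \<Longrightarrow> I (f u) \<le> m"
    and \<epsilon>: "\<epsilon> > 0" "\<And>u. u \<in> M \<Longrightarrow> I (f u) = m \<Longrightarrow> \<epsilon> < norm (I' (f u))"
  obtains W s where "continuous_on M W" "(0::real) < s" "\<And>u. u \<in> M \<Longrightarrow> norm (W u) \<le> s"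
    "\<And>u. u \<in> M \<inter> N \<Longrightarrow> W u = 0" "\<And>u. u \<in> M \<Longrightarrow> I (f u + W u) \<le> I (f u)"
    "\<And>u. u \<in> M \<Longrightarrow> I (f u + W u) \<le> m - \<epsilon> * s / 4"
proof -
  have cI: "continuous_on T I" for T
    using deriv by (meson continuous_at_imp_continuous_on has_derivative_continuous)
  have cIf: "continuous_on T (\<lambda>u. I (f u))" if "T \<subseteq> M" for T
    using continuous_on_compose2[OF cI[of UNIV] continuous_on_subset[OF f that]] by auto
  define K where "K = {u \<in> M. I (f u) = m}"
  have K: "compact K" "K \<subseteq> M"
  proof -
    have "closedin (top_of_set M) {u \<in> M. I (f u) \<in> {m}}"
      using continuous_closedin_preimage_constant[OF cIf[OF order_refl], of m] by simp
    then show "compact K" using M closedin_compact by (simp add: K_def)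
  qed (auto simp: K_def)
  have KN: "K \<inter> N = {}" using N(2) by (force simp: K_def)
  have cG: "continuous_on M (\<lambda>u. I' (f u))"
    by (rule continuous_on_compose2[OF cont f]) auto
  obtain V \<phi> where V: "continuous_on M V" and \<phi>: "continuous_on M \<phi>"
    and \<phi>01: "\<And>u. 0 \<le> \<phi> u" "\<And>u. \<phi> u \<le> (1::real)" and \<phi>K: "\<And>u. u \<in> K \<Longrightarrow> \<phi> u = 1"
    and \<phi>N: "\<And>u. u \<in> N \<Longrightarrow> \<phi> u = 0"
    and normV: "\<And>u. norm (V u) \<le> \<phi> u"
    and desc: "\<And>u. u \<in> M \<Longrightarrow> I' (f u) (V u) \<le> - \<epsilon> * \<phi> u"
    by (rule descent_field[OF K cG N(1) KN, of \<epsilon>]) (use \<epsilon> in \<open>auto simp: K_def\<close>)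
  \<comment> \<open>Within distance \<open>d\<close> of the image, \<open>I'\<close> varies by less than half of the slope of the field.\<close>
  obtain d where d: "d > 0"
    "\<And>x y. x \<in> f ` M \<Longrightarrow> dist x y < d \<Longrightarrow> dist (I' x) (I' y) < \<epsilon> / 2"
    using uniformly_continuous_near_compact[OF compact_continuous_image[OF f M] cont, of "\<epsilon>/2"] \<epsilon>(1)
    by auto
  have dec: "I (f u + t *\<^sub>R V u) \<le> I (f u) - t * \<epsilon> / 2 * \<phi> u" if u: "u \<in> M" and t: "0 \<le> t" "t < d" for u t
  proof -
    have small: "norm (t *\<^sub>R V u) \<le> t * \<phi> u"
      using normV[of u] t by (simp add: mult_left_mono)
    have "t * \<phi> u \<le> t" using \<phi>01 t by (simp add: mult_left_le)
    have "norm (I (f u + t *\<^sub>R V u) - I (f u) - I' (f u) (f u + t *\<^sub>R V u - f u))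
        \<le> norm (f u + t *\<^sub>R V u - f u) * (\<epsilon> / 2)"
    proof (rule differentiable_bound_linearization[where S = "ball (f u) d"])
      show "f u + r *\<^sub>R (f u + t *\<^sub>R V u - f u) \<in> ball (f u) d" if "r \<in> {0..1}" for r
      proof -
        have "norm (r *\<^sub>R (t *\<^sub>R V u)) \<le> norm (t *\<^sub>R V u)"
          using that mult_left_le_one_le[of "norm (t *\<^sub>R V u)" r] by (simp del: scaleR_scaleR)
        also have "\<dots> < d" using small \<open>t * \<phi> u \<le> t\<close> t by linarith
        finally show ?thesis by (simp add: dist_norm)
      qed
      show "(I has_derivative I' x) (at x within ball (f u) d)" for x
        by (rule has_derivative_at_withinI[OF deriv])
      show "onorm (blinfun_apply (I' x) - blinfun_apply (I' (f u))) \<le> \<epsilon> / 2" if "x \<in> ball (f u) d" for x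
      proof -
        have "dist (I' (f u)) (I' x) < \<epsilon> / 2" using d(2)[of "f u" x] u that by auto
        then have "norm (I' x - I' (f u)) \<le> \<epsilon> / 2" by (simp add: dist_norm norm_minus_commute)
        then show ?thesis by (simp add: norm_blinfun.rep_eq minus_blinfun.rep_eq fun_diff_def)
      qed
    qed (use d in auto)
    from abs_le_D1[OF this[unfolded real_norm_def]]
    have "I (f u + t *\<^sub>R V u) \<le> I (f u) + t * I' (f u) (V u) + norm (t *\<^sub>R V u) * (\<epsilon> / 2)"
      by (simp add: blinfun.scaleR_right)
    also have "\<dots> \<le> I (f u) + t * (- \<epsilon> * \<phi> u) + (t * \<phi> u) * (\<epsilon> / 2)"
      using desc[OF u] t small \<epsilon>(1) by (intro add_mono mult_left_mono mult_right_mono) auto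
    finally show ?thesis by (simp add: algebra_simps)
  qed
  define L where "L = {u \<in> M. \<phi> u \<le> 1/2}"
  have L: "compact L" "L \<subseteq> M"
  proof -
    have "closedin (top_of_set M) (M \<inter> \<phi> -` {..1/2})"
      by (rule continuous_closedin_preimage[OF \<phi>]) auto
    moreover have "M \<inter> \<phi> -` {..1/2} = L" by (auto simp: L_def)
    ultimately show "compact L" using M closedin_compact by metis
  qed (auto simp: L_def)
  obtain \<tau> where \<tau>: "\<tau> > 0" "\<And>u. u \<in> L \<Longrightarrow> I (f u) \<le> m - \<tau>"
  proof (cases "L = {}")
    case True then show thesis using that[of 1] by auto
  next
    case False
    obtain y where y: "y \<in> L" "\<forall>u\<in>L. I (f u) \<le> I (f y)"
      using continuous_attains_sup[OF L(1) False cIf[OF L(2)]] by blast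
    have "y \<notin> K" using \<phi>K[of y] y(1) by (auto simp: L_def)
    then have "I (f y) < m" using y(1) m[of y] by (force simp: K_def L_def)
    then show thesis using that[of "m - I (f y)"] y(2) by auto
  qed
  define t where "t = min (d/2) (4 * \<tau> / \<epsilon>)"
  have t: "0 < t" "t < d" "\<epsilon> * t / 4 \<le> \<tau>"
  proof -
    show "0 < t" "t < d" using d(1) \<tau>(1) \<epsilon>(1) by (auto simp: t_def)
    have "t \<le> 4 * \<tau> / \<epsilon>" by (simp add: t_def)
    then show "\<epsilon> * t / 4 \<le> \<tau>" using \<epsilon>(1) by (simp add: field_simps)
  qed
  show thesis
  proof (rule that[of "\<lambda>u. t *\<^sub>R V u" t])
    show "continuous_on M (\<lambda>u. t *\<^sub>R V u)" by (intro continuous_intros V)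
    show "0 < t" by (rule t)
    show "norm (t *\<^sub>R V u) \<le> t" for u
      using normV[of u] \<phi>01(2)[of u] t(1) by (simp add: mult_left_le)
    show "t *\<^sub>R V u = 0" if "u \<in> M \<inter> N" for u
      using normV[of u] \<phi>N that by auto
    fix u assume u: "u \<in> M"
    have D: "I (f u + t *\<^sub>R V u) \<le> I (f u) - t * \<epsilon> / 2 * \<phi> u" using dec u t by simp
    have nn: "0 \<le> t * \<epsilon> / 2 * \<phi> u" using t \<epsilon> \<phi>01 by simp
    show "I (f u + t *\<^sub>R V u) \<le> I (f u)" using D nn by linarith
    show "I (f u + t *\<^sub>R V u) \<le> m - \<epsilon> * t / 4"
    proof (cases "u \<in> L")
      case True
      then show ?thesis using \<tau>(2)[of u] t(3) D nn by linarith
    next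
      case False
      then have "1/2 \<le> \<phi> u" using u by (auto simp: L_def)
      then have "t * \<epsilon> / 2 * (1/2) \<le> t * \<epsilon> / 2 * \<phi> u" using t \<epsilon> by (intro mult_left_mono) auto
      then show ?thesis using D m[OF u] by (simp add: algebra_simps)
    qed
  qed
qed

text \<open>The usual minimax principle locates an almost critical point near the image of an almost optimal
map \<open>\<eta>\<close>, but not near a \<^emph>\<open>high\<close> point of that image. Ekeland's principle is therefore applied to
the closed set of those competitors \<open>f\<close> that satisfy \<open>I (f u) \<le> I (\<eta> u)\<close> at every \<open>u\<close>. A point
\<open>w = f u\<close> where \<open>I \<circ> f\<close> is maximal then has \<open>I (\<eta> u) \<ge> I w \<ge> c\<close> and lies within \<open>\<delta>\<close> of
\<open>\<eta> u\<close>. If \<open>I'\<close> were large at all of these maxima, \<open>one_step_decrease\<close> would give a better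
competitor. It respects the constraint because it raises \<open>I\<close> nowhere.

The retraction \<open>r\<close> turns maps on \<open>M\<close> into bounded continuous maps on the whole type, which form a
complete metric space.\<close>
lemma constrained_minimax_principle:
  fixes I :: "'a::banach \<Rightarrow> real" and I' :: "'a \<Rightarrow> 'a \<Rightarrow>\<^sub>L real"
    and \<eta> :: "'m::metric_space \<Rightarrow> 'a"
  assumes deriv: "\<And>u. (I has_derivative I' u) (at u)" and cont: "continuous_on UNIV I'"
    and M: "compact M" "M \<noteq> {}"
    and r: "continuous_on UNIV r" "range r \<subseteq> M" "\<And>u. u \<in> M \<Longrightarrow> r u = u"
    and N: "closed N" "N \<subseteq> M" "\<And>u. u \<in> N \<Longrightarrow> I (\<eta> u) < c"
    and \<eta>: "continuous_on M \<eta>" "\<And>u. u \<in> M \<Longrightarrow> I (\<eta> u) \<le> c + \<kappa> * \<delta>" and \<kappa>: "\<kappa> > 0"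
    and link: "\<And>\<gamma>. continuous_on M \<gamma> \<Longrightarrow> \<forall>u\<in>N. \<gamma> u = \<eta> u \<Longrightarrow> \<exists>u\<in>M. c \<le> I (\<gamma> u)"
  obtains u w where "u \<in> M" "c \<le> I w" "I w \<le> I (\<eta> u)" "norm (w - \<eta> u) \<le> \<delta>" "norm (I' w) \<le> 4 * \<kappa>"
proof -
  have cI: "continuous_on T I" for T
    using deriv by (meson continuous_at_imp_continuous_on has_derivative_continuous)
  define E where "E = {f :: 'm \<Rightarrow>\<^sub>C 'a. (\<forall>u\<in>N. f u = \<eta> u) \<and> (\<forall>u\<in>M. I (f u) \<le> I (\<eta> u))}"
  define \<Phi> where "\<Phi> f = (SUP u\<in>M. I (f u))" for f :: "'m \<Rightarrow>\<^sub>C 'a"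
  have cIf: "continuous_on M (\<lambda>u. I (f u))" for f :: "'m \<Rightarrow>\<^sub>C 'a"
    by (rule continuous_on_compose2[OF cI[of UNIV]]) auto
  have bdd: "bdd_above ((\<lambda>u. I (f u)) ` M)" for f :: "'m \<Rightarrow>\<^sub>C 'a"
    by (intro bounded_imp_bdd_above compact_imp_bounded compact_continuous_image cIf M)
  have \<Phi>_upper: "I (f u) \<le> \<Phi> f" if "u \<in> M" for f :: "'m \<Rightarrow>\<^sub>C 'a" and u
    unfolding \<Phi>_def using bdd that by (rule cSUP_upper2) auto
  have \<Phi>_le: "\<Phi> f \<le> a \<longleftrightarrow> (\<forall>u\<in>M. I (f u) \<le> a)" for f :: "'m \<Rightarrow>\<^sub>C 'a" and a
    unfolding \<Phi>_def using bdd M(2) by (subst cSUP_le_iff) auto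
  have \<Phi>_attained: "\<exists>u\<in>M. I (f u) = \<Phi> f" for f :: "'m \<Rightarrow>\<^sub>C 'a"
  proof -
    obtain u where "u \<in> M" "\<forall>v\<in>M. I (f v) \<le> I (f u)"
      using continuous_attains_sup[OF M cIf] by blast
    then show ?thesis using \<Phi>_le \<Phi>_upper by (metis order_antisym order_refl)
  qed
  have \<Phi>_ge: "c \<le> \<Phi> f" if "f \<in> E" for f
  proof -
    have "\<exists>u\<in>M. c \<le> I (f u)" using that by (intro link) (auto simp: E_def)
    then show ?thesis using \<Phi>_upper order_trans by blast
  qed
  have extend: "\<exists>F :: 'm \<Rightarrow>\<^sub>C 'a. \<forall>u. F u = g (r u)" if "continuous_on M g" for g :: "'m \<Rightarrow> 'a"
  proof -
    have "continuous_on UNIV (\<lambda>u. g (r u))" by (rule continuous_on_compose2[OF that r(1)]) (use r in auto)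
    moreover have "bounded (range (\<lambda>u. g (r u)))"
      using compact_imp_bounded[OF compact_continuous_image[OF that M(1)]]
      by (rule bounded_subset) (use r in auto)
    ultimately have "(\<lambda>u. g (r u)) \<in> bcontfun" by (simp add: bcontfun_def)
    then show ?thesis by (metis bcontfunE)
  qed
  obtain f0 :: "'m \<Rightarrow>\<^sub>C 'a" where f0: "\<And>u. f0 u = \<eta> (r u)" using extend[OF \<eta>(1)] by blast
  have f0E: "f0 \<in> E" using f0 r N by (auto simp: E_def)
  have eval: "continuous_on UNIV (\<lambda>f :: 'm \<Rightarrow>\<^sub>C 'a. f u)" for u
    unfolding continuous_on_iff using dist_fun_lt_imp_dist_val_lt by blast
  have evalI: "continuous_on UNIV (\<lambda>f :: 'm \<Rightarrow>\<^sub>C 'a. I (f u))" for u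
    by (rule continuous_on_compose2[OF cI[of UNIV] eval]) auto
  have lsc: "closed {f \<in> E. \<Phi> f \<le> a}" for a
  proof -
    have "{f \<in> E. \<Phi> f \<le> a} = (\<Inter>u\<in>N. {f. apply_bcontfun f u = \<eta> u}) \<inter>
        (\<Inter>u\<in>M. {f. I (apply_bcontfun f u) \<le> I (\<eta> u)} \<inter> {f. I (apply_bcontfun f u) \<le> a})"
      by (auto simp: E_def \<Phi>_le)
    moreover have "closed \<dots>"
      by (intro closed_Int closed_INT ballI closed_Collect_le closed_Collect_eq eval evalI continuous_on_const)
    ultimately show ?thesis by simp
  qed
  obtain f where fE: "f \<in> E" and f1: "\<Phi> f + \<kappa> * dist f0 f \<le> \<Phi> f0"
    and f2: "\<And>g. g \<in> E \<Longrightarrow> g \<noteq> f \<Longrightarrow> \<Phi> f < \<Phi> g + \<kappa> * dist f g"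
    using ekeland_variational_principle[where f = \<Phi> and m = c, OF f0E \<Phi>_ge lsc \<kappa>] by blast
  have "\<Phi> f0 \<le> c + \<kappa> * \<delta>" using \<eta>(2) r(3) f0 by (simp add: \<Phi>_le)
  then have "\<kappa> * dist f0 f \<le> \<kappa> * \<delta>" using f1 \<Phi>_ge[OF fE] by linarith
  then have dist: "dist f0 f \<le> \<delta>" using \<kappa> by simp
  \<comment> \<open>The factor \<open>4\<close> makes the gain \<open>4 * \<kappa> * s / 4\<close> of one step equal to the Ekeland penalty \<open>\<kappa> * s\<close>.\<close>
  have "\<exists>u\<in>M. I (f u) = \<Phi> f \<and> norm (I' (f u)) \<le> 4 * \<kappa>"
  proof (rule ccontr)
    assume neg: "\<not> ?thesis"
    have N': "I (f u) < \<Phi> f" if "u \<in> M \<inter> N" for u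
      using fE N(3)[of u] \<Phi>_ge[OF fE] that by (auto simp: E_def)
    obtain W s where W: "continuous_on M W" "0 < s" "\<And>u. u \<in> M \<Longrightarrow> norm (W u) \<le> s"
      "\<And>u. u \<in> M \<inter> N \<Longrightarrow> W u = 0" "\<And>u. u \<in> M \<Longrightarrow> I (f u + W u) \<le> I (f u)"
      "\<And>u. u \<in> M \<Longrightarrow> I (f u + W u) \<le> \<Phi> f - 4 * \<kappa> * s / 4"
      by (rule one_step_decrease[OF deriv cont M(1) _ N(1) N' \<Phi>_upper, where \<epsilon> = "4 * \<kappa>"])
        (use \<kappa> neg in \<open>auto simp: not_le\<close>)
    obtain F :: "'m \<Rightarrow>\<^sub>C 'a" where F: "\<And>u. F u = W (r u)" using extend[OF W(1)] by blast
    define g where "g = f + F"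
    have g: "g u = f u + W u" if "u \<in> M" for u using that r F by (simp add: g_def)
    have "g \<in> E" using fE W(4,5) N(2) g by (force simp: E_def)
    moreover have \<Phi>g: "\<Phi> g \<le> \<Phi> f - \<kappa> * s" using W(6) g by (simp add: \<Phi>_le)
    moreover have "g \<noteq> f" using \<Phi>g mult_pos_pos[OF \<kappa> W(2)] by auto
    ultimately have "\<kappa> * s < \<kappa> * dist f g" using f2[of g] by linarith
    moreover have "dist f g \<le> s"
    proof (rule dist_bound)
      show "dist (f x) (g x) \<le> s" for x
        using W(3)[of "r x"] r(2) by (auto simp: g_def F dist_norm)
    qed
    ultimately show False using \<kappa> by simp
  qed
  then obtain u where u: "u \<in> M" "I (f u) = \<Phi> f" "norm (I' (f u)) \<le> 4 * \<kappa>" by blast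
  show thesis
  proof (rule that[of u "f u"])
    show "norm (f u - \<eta> u) \<le> \<delta>"
      using dist dist_bounded[of f0 u f] u(1) f0 r(3) by (simp add: dist_norm norm_minus_commute)
  qed (use u fE \<Phi>_ge in \<open>auto simp: E_def\<close>)
qed

section \<open>Finite-dimensional balls and linking\<close>

lemma continuous_on_coordinate: "continuous_on T (\<lambda>x :: nat \<Rightarrow> real. x i)"
  by (rule continuous_on_subset[OF continuous_on_product_coordinates]) simp

definition coord_space :: "nat \<Rightarrow> (nat \<Rightarrow> real) set" where
  "coord_space n = {x. \<forall>i\<ge>n. x i = 0}"

text \<open>In a general normed space the coordinates with respect to a finite basis are bounded because the
norm of a linear combination has a positive minimum over the coefficient vectors of maximum norm 1,
which form a compact set \<open>S1\<close>. Coefficient vectors are sequences vanishing from \<open>n\<close> on, so that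
\<open>n\<close> is a number rather than a type, as for the spheres \<open>nsphere\<close>.\<close>
lemma finite_dim_coordinates:
  fixes Y :: "'a::real_normed_vector set"
  assumes "finite_dim_subspace Y"
  obtains n L q C where "continuous_on UNIV (L :: (nat \<Rightarrow> real) \<Rightarrow> 'a)" "\<And>x. L x \<in> Y"
    "\<And>a x. L (\<lambda>i. a * x i) = a *\<^sub>R L x"
    "continuous_on Y q" "\<And>y. y \<in> Y \<Longrightarrow> q y \<in> coord_space n" "\<And>y. y \<in> Y \<Longrightarrow> L (q y) = y"
    "\<And>x. x \<in> coord_space n \<Longrightarrow> q (L x) = x"
    "\<And>y i. y \<in> Y \<Longrightarrow> \<bar>q y i\<bar> \<le> C * norm y"
proof -
  obtain S where S: "finite S" "span S = Y" "subspace Y"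
    using assms by (auto simp: finite_dim_subspace_def)
  obtain B where B: "B \<subseteq> S" "independent B" "S \<subseteq> span B"
    using maximal_independent_subset[of S] by blast
  have finB: "finite B" using B(1) S(1) by (rule finite_subset)
  have spanB: "span B = Y" using B S by (metis span_eq span_superset subset_trans)
  define n where "n = card B"
  obtain b where b: "bij_betw b {..<n} B"
    using ex_bij_betw_nat_finite[OF finB] by (auto simp: n_def lessThan_atLeast0)
  define L where "L x = (\<Sum>i<n. x i *\<^sub>R b i)" for x :: "nat \<Rightarrow> real"
  have bB: "b i \<in> B" if "i < n" for i using b that by (auto simp: bij_betw_def)
  have contL: "continuous_on UNIV L" 
    unfolding L_def by (intro continuous_on_sum continuous_on_scaleR continuous_on_const continuous_on_coordinate)
  have LY: "L x \<in> Y" for x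
    unfolding L_def spanB[symmetric] by (intro span_sum span_scale span_base bB) auto
  have Lscale: "L (\<lambda>i. a * x i) = a *\<^sub>R L x" for a x by (simp add: L_def scaleR_sum_right)
  have Ldiff: "L (\<lambda>i. x i - y i) = L x - L y" for x y
    by (simp add: L_def scaleR_diff_left sum_subtractf)
  define idx where "idx = the_inv_into {..<n} b"
  have idx: "idx (b i) = i" if "i < n" for i
    using that b by (auto simp: idx_def bij_betw_def the_inv_into_f_f)
  have Lzero: "x i = 0" if "L x = 0" "i < n" for x i
  proof -
    have "(\<Sum>v\<in>B. x (idx v) *\<^sub>R v) = L x"
      unfolding L_def by (rule sum.reindex_bij_betw[OF b, symmetric, THEN trans]) (simp add: idx)
    then have "\<forall>v\<in>B. x (idx v) = 0"
      using independentD[OF B(2) finB order_refl] \<open>L x = 0\<close> by metis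
    then show ?thesis using idx bB that(2) by metis
  qed
  have Lsurj: "\<exists>x\<in>coord_space n. L x = y" if "y \<in> Y" for y
  proof -
    obtain u where u: "(\<Sum>v\<in>B. u v *\<^sub>R v) = y"
      using \<open>y \<in> Y\<close> span_finite[OF finB] spanB by auto
    have "L (\<lambda>i. if i < n then u (b i) else 0) = y"
      unfolding L_def u[symmetric] by (simp add: sum.reindex_bij_betw[OF b, symmetric])
    then show ?thesis by (intro bexI) (auto simp: coord_space_def)
  qed
  define S1 where "S1 = PiE UNIV (\<lambda>i. if i < n then {-1..1::real} else {0}) \<inter> (\<Union>i<n. {x. \<bar>x i\<bar> = 1})"
  have "compactin (product_topology (\<lambda>i. euclidean) UNIV) (PiE UNIV (\<lambda>i. if i < n then {-1..1::real} else {0}))"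
    by (subst compactin_PiE) auto
  then have "compact (PiE UNIV (\<lambda>i::nat. if i < n then {-1..1::real} else {0}))"
    by (simp add: euclidean_product_topology)
  moreover have "closed (\<Union>i<n. {x :: nat \<Rightarrow> real. \<bar>x i\<bar> = 1})"
    by (intro closed_UN ballI closed_Collect_eq continuous_on_rabs continuous_on_const continuous_on_coordinate) auto
  ultimately have S1: "compact S1" unfolding S1_def by (rule compact_Int_closed)
  obtain m where m: "m > 0" "\<And>x. x \<in> S1 \<Longrightarrow> m \<le> norm (L x)"
  proof (cases "S1 = {}")
    case True then show thesis using that[of 1] by auto
  next
    case False
    have "continuous_on S1 (\<lambda>x. norm (L x))"
      using continuous_on_subset[OF contL] by (intro continuous_intros) auto
    then obtain x where x: "x \<in> S1" "\<forall>y\<in>S1. norm (L x) \<le> norm (L y)"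
      using continuous_attains_inf[OF S1 False] by blast
    have "L x \<noteq> 0" using x(1) Lzero by (force simp: S1_def)
    then show thesis using that[of "norm (L x)"] x(2) by auto
  qed
  have bound: "\<bar>x i\<bar> \<le> (1/m) * norm (L x)" if x: "x \<in> coord_space n" for x i
  proof (cases "n = 0 \<or> (\<forall>j<n. x j = 0)")
    case True
    then have "x i = 0" using x by (cases "i < n") (auto simp: coord_space_def)
    then show ?thesis using m by simp
  next
    case False
    define k where "k = Max ((\<lambda>j. \<bar>x j\<bar>) ` {..<n})"
    have k: "\<bar>x j\<bar> \<le> k" if "j < n" for j using that by (auto simp: k_def)
    have "k \<in> (\<lambda>j. \<bar>x j\<bar>) ` {..<n}" unfolding k_def using False by (intro Max_in) auto
    then obtain j where j: "j < n" "\<bar>x j\<bar> = k" by auto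
    obtain j' where "j' < n" "x j' \<noteq> 0" using False by auto
    with k[of j'] have k0: "k > 0" by (simp add: abs_le_iff)
    have "(\<lambda>i. (1/k) * x i) \<in> S1"
    proof -
      have "(1/k) * x i \<in> {-1..1}" if "i < n" for i
        using k[OF that] k0 by (auto simp: field_simps abs_le_iff)
      moreover have "\<bar>(1/k) * x j\<bar> = 1" using j k0 by (simp add: abs_mult)
      ultimately show ?thesis using j(1) x unfolding S1_def by (auto simp: PiE_iff coord_space_def)
    qed
    from m(2)[OF this] have "m \<le> (1/k) * norm (L x)" using k0 unfolding Lscale by simp
    then have "k \<le> (1/m) * norm (L x)" using k0 m(1) by (simp add: field_simps)
    moreover have "\<bar>x i\<bar> \<le> k" using k[of i] x k0 by (cases "i < n") (auto simp: coord_space_def)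
    ultimately show ?thesis by linarith
  qed
  define q where "q y = (SOME x. x \<in> coord_space n \<and> L x = y)" for y
  have q: "q y \<in> coord_space n \<and> L (q y) = y" if "y \<in> Y" for y
    unfolding q_def using Lsurj[OF that] by (intro someI_ex[where P = "\<lambda>x. x \<in> coord_space n \<and> L x = y"]) blast
  have qdist: "\<bar>q y i - x i\<bar> \<le> (1/m) * norm (y - L x)" if "y \<in> Y" "x \<in> coord_space n" for x y i
  proof -
    have "(\<lambda>i. q y i - x i) \<in> coord_space n" using q[OF that(1)] that(2) by (auto simp: coord_space_def)
    from bound[OF this, of i] show ?thesis using q[OF that(1)] by (simp add: Ldiff)
  qed
  show thesis
  proof (rule that[of L q n "1/m"])
    show "continuous_on Y q"
    proof (rule continuous_on_coordinatewise_then_product)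
      fix i
      have "(1/m)-lipschitz_on Y (\<lambda>y. q y i)"
      proof (rule lipschitz_onI)
        fix y z assume "y \<in> Y" "z \<in> Y"
        then show "dist (q y i) (q z i) \<le> 1/m * dist y z"
          using qdist[of y "q z" i] q[of z] by (simp add: dist_norm)
      qed (use m in simp)
      then show "continuous_on Y (\<lambda>y. q y i)" by (rule lipschitz_on_continuous_on)
    qed
    show "q (L x) = x" if "x \<in> coord_space n" for x
      using qdist[OF LY that, of x] by (auto simp: fun_eq_iff)
    show "\<bar>q y i\<bar> \<le> 1/m * norm y" if "y \<in> Y" for y i
      using bound[of "q y" i] q[OF that] by simp
  qed (use contL LY Lscale q in auto)
qed

lemma compact_M_ball:
  fixes Y :: "'a::real_normed_vector set"
  assumes "finite_dim_subspace Y" "closed Y"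
  shows "compact (M_ball Y \<rho>)"
proof -
  obtain n L q C where L: "continuous_on UNIV (L :: (nat \<Rightarrow> real) \<Rightarrow> 'a)"
    and q: "\<And>y. y \<in> Y \<Longrightarrow> q y \<in> coord_space n" "\<And>y. y \<in> Y \<Longrightarrow> L (q y) = y"
    and C: "\<And>y i. y \<in> Y \<Longrightarrow> \<bar>q y i\<bar> \<le> C * norm y"
    using finite_dim_coordinates[OF assms(1)] by metis
  define D where "D = \<bar>C\<bar> * \<rho>"
  define Q where "Q = PiE UNIV (\<lambda>i::nat. {-D..D})"
  have "compactin (product_topology (\<lambda>i. euclidean) UNIV) Q"
    unfolding Q_def by (subst compactin_PiE) auto
  then have Q: "compact Q" by (simp add: euclidean_product_topology)
  have "compact (L ` Q)" by (rule compact_continuous_image[OF continuous_on_subset[OF L] Q]) auto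
  moreover have "closed (M_ball Y \<rho>)"
  proof -
    have "M_ball Y \<rho> = Y \<inter> cball 0 \<rho>" by (auto simp: M_ball_def)
    then show ?thesis using assms(2) by (simp add: closed_Int)
  qed
  moreover have "M_ball Y \<rho> \<subseteq> L ` Q"
  proof
    fix y assume y: "y \<in> M_ball Y \<rho>"
    have "\<bar>q y i\<bar> \<le> D" for i
    proof -
      have "C * norm y \<le> \<bar>C\<bar> * norm y" by (intro mult_right_mono) auto
      also have "\<dots> \<le> D" unfolding D_def using y by (intro mult_left_mono) (auto simp: M_ball_def)
      finally show ?thesis using C[of y i] y by (auto simp: M_ball_def)
    qed
    then have "q y \<in> Q" by (auto simp: Q_def abs_le_iff PiE_iff minus_le_iff)
    then show "y \<in> L ` Q" using q(2)[of y] y by (force simp: M_ball_def)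
  qed
  ultimately show ?thesis by (metis compact_Int_closed inf.absorb2)
qed

text \<open>A nowhere vanishing \<open>F\<close> would contract the sphere. For a unit coefficient vector \<open>x\<close>, let
\<open>e t x\<close> run along the radius of the ball from \<open>0\<close> to the boundary point in the direction of
\<open>L x\<close>. Normalising the coordinates of \<open>F (e t x)\<close> is a homotopy on \<open>nsphere p\<close> from a constant to
the identity, although these have degrees \<open>0\<close> and \<open>1\<close>.\<close>
lemma ball_map_has_zero:
  fixes Y :: "'a::real_normed_vector set"
  assumes Y: "finite_dim_subspace Y" and \<rho>: "\<rho> > 0"
    and F: "continuous_on (M_ball Y \<rho>) F" "\<And>u. u \<in> M_ball Y \<rho> \<Longrightarrow> F u \<in> Y"
    and id: "\<And>u. u \<in> M_sphere Y \<rho> \<Longrightarrow> F u = u"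
  shows "\<exists>u\<in>M_ball Y \<rho>. F u = 0"
proof (rule ccontr)
  assume "\<not> ?thesis"
  then have F0: "\<And>u. u \<in> M_ball Y \<rho> \<Longrightarrow> F u \<noteq> 0" by blast
  have sub: "subspace Y" using Y by (simp add: finite_dim_subspace_def)
  obtain n L q C where L: "continuous_on UNIV (L :: (nat \<Rightarrow> real) \<Rightarrow> 'a)" "\<And>x. L x \<in> Y"
    "\<And>a x. L (\<lambda>i. a * x i) = a *\<^sub>R L x"
    and q: "continuous_on Y q" "\<And>y. y \<in> Y \<Longrightarrow> q y \<in> coord_space n" "\<And>y. y \<in> Y \<Longrightarrow> L (q y) = y"
    "\<And>x. x \<in> coord_space n \<Longrightarrow> q (L x) = x"
    "\<And>y i. y \<in> Y \<Longrightarrow> \<bar>q y i\<bar> \<le> C * norm y"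
  proof (rule finite_dim_coordinates[OF Y], goal_cases)
    case (1 n L q C)
    show ?thesis by (rule 1(1)[OF 1(2-9)])
  qed
  have L0: "L (\<lambda>i. 0) = 0" using L(3)[of 0 "\<lambda>i. 0"] by simp
  have zero_in: "0 \<in> M_ball Y \<rho>" using sub \<rho> by (simp add: M_ball_def subspace_0)
  have q_nz: "q y \<noteq> (\<lambda>i. 0)" if "y \<in> Y" "y \<noteq> 0" for y using q(3)[OF that(1)] that(2) L0 by metis
  \<comment> \<open>In dimension \<open>0\<close> the value \<open>F 0\<close> can only be \<open>0\<close>.\<close>
  have "n \<noteq> 0"
  proof
    assume "n = 0"
    then have "q (F 0) = (\<lambda>i. 0)" using q(2)[OF F(2)[OF zero_in]] by (auto simp: coord_space_def)
    then show False using q_nz F(2) F0 zero_in by blast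
  qed
  then obtain p where p: "n = Suc p" using not0_implies_Suc by blast
  define S where "S = {x :: nat \<Rightarrow> real. (\<Sum>i\<le>p. x i ^ 2) = 1 \<and> (\<forall>i>p. x i = 0)}"
  have S: "nsphere p = top_of_set S" by (simp add: nsphere S_def euclidean_product_topology)
  define R where "R x = sqrt (\<Sum>i\<le>p. x i ^ 2)" for x :: "nat \<Rightarrow> real"
  define normalise where "normalise x = (\<lambda>i. x i / R x)" for x :: "nat \<Rightarrow> real"
  have Rpos: "R x > 0" if "x \<in> coord_space n" "x \<noteq> (\<lambda>i. 0)" for x
  proof -
    obtain i where i: "x i \<noteq> 0" using \<open>x \<noteq> (\<lambda>i. 0)\<close> by auto
    have "i \<le> p"
    proof (rule ccontr)
      assume "\<not> i \<le> p"
      then have "n \<le> i" using p by simp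
      then show False using i \<open>x \<in> coord_space n\<close> by (simp add: coord_space_def)
    qed
    then have "(\<Sum>i\<le>p. x i ^ 2) > 0" by (rule_tac sum_pos2[of _ i]) (use i in simp_all)
    then show ?thesis by (simp add: R_def)
  qed
  have normalise_S: "normalise x \<in> S" if "x \<in> coord_space n" "x \<noteq> (\<lambda>i. 0)" for x
  proof -
    have "(\<Sum>i\<le>p. (x i / R x)\<^sup>2) = (\<Sum>i\<le>p. x i ^ 2) / (R x)\<^sup>2"
      unfolding power_divide by (rule sum_divide_distrib[symmetric])
    also have "(\<Sum>i\<le>p. x i ^ 2) = (R x)\<^sup>2" unfolding R_def by (rule real_sqrt_pow2[symmetric]) (rule sum_nonneg, simp)
    also have "(R x)\<^sup>2 / (R x)\<^sup>2 = 1" using Rpos[OF that] by simp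
    finally show ?thesis using that(1) p by (auto simp: S_def normalise_def coord_space_def)
  qed
  have cont_normalise: "continuous_on {x. x \<in> coord_space n \<and> x \<noteq> (\<lambda>i. 0)} normalise"
    unfolding normalise_def
  proof (rule continuous_on_coordinatewise_then_product, intro continuous_on_divide continuous_on_coordinate ballI)
    show "continuous_on {x. x \<in> coord_space n \<and> x \<noteq> (\<lambda>i. 0)} R"
      unfolding R_def
      by (rule continuous_on_real_sqrt, rule continuous_on_sum, rule continuous_on_power,
          rule continuous_on_coordinate)
    show "R x \<noteq> 0" if "x \<in> {x. x \<in> coord_space n \<and> x \<noteq> (\<lambda>i. 0)}" for x
      using Rpos[of x] that by simp
  qed
  have S_coord: "x \<in> coord_space n" "x \<noteq> (\<lambda>i. 0)" if "x \<in> S" for x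
    using that p by (auto simp: S_def coord_space_def)
  have Lnz: "L x \<noteq> 0" if "x \<in> S" for x
  proof
    assume "L x = 0"
    then have "x = q 0" using q(4)[OF S_coord(1)[OF that]] by simp
    moreover have "q 0 = (\<lambda>i. 0)" using q(4)[of "\<lambda>i. 0"] L0 by (simp add: coord_space_def)
    ultimately show False using S_coord(2)[OF that] by simp
  qed
  define e where "e t x = (t * \<rho> / norm (L x)) *\<^sub>R L x" for t :: real and x
  have e: "e t x \<in> M_ball Y \<rho>" if "t \<in> {0..1}" "x \<in> S" for t x
    using that \<rho> Lnz[OF that(2)] L(2)[of x] sub
    by (auto simp: e_def M_ball_def subspace_scale mult_left_le_one_le)
  define h where "h z = normalise (q (F (e (fst z) (snd z))))" for z
  have core: "q (F (e t x)) \<in> coord_space n" "q (F (e t x)) \<noteq> (\<lambda>i. 0)" if "t \<in> {0..1}" "x \<in> S" for t x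
  proof -
    have "F (e t x) \<in> Y" "F (e t x) \<noteq> 0" using F(2) F0 e[OF that] by blast+
    then show "q (F (e t x)) \<in> coord_space n" "q (F (e t x)) \<noteq> (\<lambda>i. 0)" using q(2) q_nz by blast+
  qed
  have cont_e: "continuous_on ({0..1} \<times> S) (\<lambda>z. e (fst z) (snd z))"
    unfolding e_def
    by (intro continuous_intros continuous_on_compose2[OF L(1)]) (use Lnz in auto)
  have "continuous_on ({0..1} \<times> S) h"
    unfolding h_def
  proof (rule continuous_on_compose2[OF cont_normalise])
    show "continuous_on ({0..1} \<times> S) (\<lambda>z. q (F (e (fst z) (snd z))))"
      by (rule continuous_on_compose2[OF q(1)], rule continuous_on_compose2[OF F(1) cont_e])
        (use e F(2) in \<open>auto simp: image_subset_iff\<close>)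
    show "(\<lambda>z. q (F (e (fst z) (snd z)))) ` ({0..1} \<times> S) \<subseteq> {x. x \<in> coord_space n \<and> x \<noteq> (\<lambda>i. 0)}"
      using core by (auto simp del: fun_eq_iff)
  qed
  moreover have "h \<in> {0..1} \<times> S \<rightarrow> S"
    using normalise_S[OF core] unfolding h_def by (intro Pi_I) (metis SigmaE fst_conv snd_conv)
  moreover have "h (0, x) = normalise (q (F 0))" for x by (simp add: h_def e_def)
  moreover have "h (1, x) = x" if x: "x \<in> S" for x
  proof -
    define a where "a = \<rho> / norm (L x)"
    have a: "a > 0" using \<rho> Lnz[OF x] by (simp add: a_def)
    have "e 1 x \<in> M_sphere Y \<rho>"
      using \<rho> Lnz[OF x] L(2)[of x] sub by (simp add: e_def M_sphere_def subspace_scale)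
    then have "F (e 1 x) = L (\<lambda>i. a * x i)" unfolding L(3) by (simp add: id e_def a_def)
    moreover have "(\<lambda>i. a * x i) \<in> coord_space n" using S_coord[OF x] by (simp add: coord_space_def)
    ultimately have "q (F (e 1 x)) = (\<lambda>i. a * x i)" using q(4) by simp
    moreover have "R (\<lambda>i. a * x i) = a"
      using x a by (simp add: R_def S_def power_mult_distrib flip: sum_distrib_left)
    ultimately show ?thesis using a by (simp add: h_def normalise_def)
  qed
  ultimately have "homotopic_with_canon (\<lambda>x. True) S S (\<lambda>x. normalise (q (F 0))) id"
    by (intro homotopic_with[THEN iffD2] exI[of _ h]) simp_all
  then have "Brouwer_degree2 p (\<lambda>x. normalise (q (F 0))) = Brouwer_degree2 p id"
    by (intro Brouwer_degree2_homotopic) (simp add: S)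
  then show False by (simp add: Brouwer_degree2_const)
qed

lemma topological_direct_sum_projection:
  assumes "topological_direct_sum Y Z"
  obtains P where "continuous_on UNIV P" "\<And>x. P x \<in> Y" "\<And>y. y \<in> Y \<Longrightarrow> P y = y" "\<And>x. P x = 0 \<Longrightarrow> x \<in> Z"
proof -
  obtain p where p: "homeomorphism (Y \<times> Z) UNIV (\<lambda>(y, z). y + z) p" and sZ: "subspace Z"
    using assms by (auto simp: topological_direct_sum_def)
  have pv: "p v \<in> Y \<times> Z" "(\<lambda>(y, z). y + z) (p v) = v" for v
    using p unfolding homeomorphism_def by blast+
  have pp: "p (y + z) = (y, z)" if "y \<in> Y" "z \<in> Z" for y z
    using p that by (force simp: homeomorphism_def)
  show thesis
  proof (rule that[of "\<lambda>x. fst (p x)"])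
    show "continuous_on UNIV (\<lambda>x. fst (p x))"
      using p by (intro continuous_intros) (simp add: homeomorphism_def)
    show "fst (p x) \<in> Y" for x using pv(1)[of x] by (cases "p x") auto
    show "fst (p y) = y" if "y \<in> Y" for y using pp[OF that subspace_0[OF sZ]] by simp
    show "x \<in> Z" if "fst (p x) = 0" for x using that pv[of x] by (cases "p x") auto
  qed
qed

text \<open>The projection onto \<open>Y\<close> along \<open>Z\<close>, composed with \<open>\<gamma>\<close>, fixes the sphere, so it vanishes somewhere.
The kernel of the projection is \<open>Z\<close>.\<close>
lemma linking_intersection:
  assumes YZ: "topological_direct_sum Y Z" and Y: "finite_dim_subspace Y" and \<rho>: "\<rho> > 0"
    and \<gamma>: "\<gamma> \<in> Gamma_maps Y \<rho>"
  shows "\<exists>u\<in>M_ball Y \<rho>. \<gamma> u \<in> Z"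
proof -
  obtain P where P: "continuous_on UNIV P" "\<And>x. P x \<in> Y" "\<And>y. y \<in> Y \<Longrightarrow> P y = y" "\<And>x. P x = 0 \<Longrightarrow> x \<in> Z"
  proof (rule topological_direct_sum_projection[OF YZ], goal_cases)
    case (1 P)
    show ?thesis by (rule 1(1)[OF 1(2-5)])
  qed
  have "\<exists>u\<in>M_ball Y \<rho>. P (\<gamma> u) = 0"
  proof (rule ball_map_has_zero[OF Y \<rho>])
    show "continuous_on (M_ball Y \<rho>) (\<lambda>u. P (\<gamma> u))"
      using \<gamma> by (intro continuous_on_compose2[OF P(1)]) (auto simp: Gamma_maps_def)
    show "P (\<gamma> u) = u" if "u \<in> M_sphere Y \<rho>" for u
      using \<gamma> that P(3) by (auto simp: Gamma_maps_def M_sphere_def)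
  qed (rule P(2))
  then show ?thesis using P(4) by blast
qed

lemma M_ball_retraction:
  assumes YZ: "topological_direct_sum Y Z" and \<rho>: "\<rho> > 0"
  obtains r where "continuous_on UNIV r" "range r \<subseteq> M_ball Y \<rho>" "\<And>u. u \<in> M_ball Y \<rho> \<Longrightarrow> r u = u"
proof -
  obtain P where P: "continuous_on UNIV P" "\<And>x. P x \<in> Y" "\<And>y. y \<in> Y \<Longrightarrow> P y = y" "\<And>x. P x = 0 \<Longrightarrow> x \<in> Z"
  proof (rule topological_direct_sum_projection[OF YZ], goal_cases)
    case (1 P)
    show ?thesis by (rule 1(1)[OF 1(2-5)])
  qed
  have Y: "subspace Y" using YZ by (simp add: topological_direct_sum_def)
  define r where "r x = (\<rho> / max \<rho> (norm (P x))) *\<^sub>R P x" for x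
  have pos: "max \<rho> t > 0" for t using \<rho> by simp
  show thesis
  proof (rule that[of r])
    show "continuous_on UNIV r"
      unfolding r_def by (intro continuous_intros P(1) ballI less_imp_neq[OF pos, symmetric])
    have "norm (r x) \<le> \<rho>" for x
    proof -
      have "\<rho> * norm (P x) \<le> \<rho> * max \<rho> (norm (P x))" using \<rho> by (intro mult_left_mono) auto
      then have "\<rho> * norm (P x) / max \<rho> (norm (P x)) \<le> \<rho>"
        by (simp only: pos_divide_le_eq[OF pos])
      then show ?thesis using \<rho> by (simp add: r_def)
    qed
    then show "range r \<subseteq> M_ball Y \<rho>"
      using P(2) Y by (auto simp: M_ball_def r_def subspace_scale)
    show "r u = u" if "u \<in> M_ball Y \<rho>" for u
      using that P(3)[of u] \<rho> by (simp add: r_def M_ball_def max_absorb1)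
  qed
qed

section \<open>Maps composed with the rescalings\<close>

text \<open>Composing \<open>\<gamma>\<close> with \<open>g\<close> destroys the boundary condition. It is restored by running \<open>g \<circ> \<gamma>\<close> on the
ball of radius \<open>\<rho> / 2\<close>, rescaled, and by joining \<open>g v\<close> to \<open>v\<close> by a segment along each radius of the
remaining collar. The map \<open>R\<close> is the radial projection of \<open>2 u\<close> to the ball, and \<open>s\<close> is the parameter
on the segment; it is positive only where \<open>R u\<close> is on the sphere.\<close>
lemma collared_path:
  fixes Y :: "'a::real_normed_vector set"
  assumes Y: "subspace Y" and \<rho>: "\<rho> > 0" and \<gamma>: "\<gamma> \<in> Gamma_maps Y \<rho>" and g: "continuous_on UNIV g"
  obtains \<eta> where "\<eta> \<in> Gamma_maps Y \<rho>"
    "\<And>u. u \<in> M_ball Y \<rho> \<Longrightarrow> (\<exists>v\<in>M_ball Y \<rho>. \<eta> u = g (\<gamma> v)) \<or>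
       (\<exists>v\<in>M_sphere Y \<rho>. \<exists>s\<in>{0..1}. \<eta> u = (1 - s) *\<^sub>R g v + s *\<^sub>R v)"
proof -
  have c\<gamma>: "continuous_on (M_ball Y \<rho>) \<gamma>" and id: "\<And>u. u \<in> M_sphere Y \<rho> \<Longrightarrow> \<gamma> u = u"
    using \<gamma> by (auto simp: Gamma_maps_def)
  define R where "R u = (2 / max 1 (2 * norm u / \<rho>)) *\<^sub>R u" for u :: 'a
  define s where "s u = max 0 (2 * norm u / \<rho> - 1)" for u :: 'a
  define \<eta> where "\<eta> u = (1 - s u) *\<^sub>R g (\<gamma> (R u)) + s u *\<^sub>R R u" for u
  have mpos: "max 1 t > (0::real)" for t by simp
  have cR: "continuous_on T R" for T unfolding R_def by (intro continuous_intros) (use mpos \<rho> in auto)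
  have cs: "continuous_on T s" for T unfolding s_def by (intro continuous_intros) (use \<rho> in auto)
  have RM: "R u \<in> M_ball Y \<rho>" if "u \<in> Y" for u
  proof -
    have "2 * norm u / max 1 (2 * norm u / \<rho>) \<le> \<rho>"
      using \<rho> by (simp add: max_def field_simps)
    then show ?thesis using that Y by (simp add: R_def M_ball_def subspace_scale)
  qed
  have RS: "R u \<in> M_sphere Y \<rho>" if "u \<in> Y" "s u > 0" for u
  proof -
    have "2 * norm u / \<rho> > 1" using that(2) by (auto simp: s_def max_def split: if_splits)
    moreover from this have "u \<noteq> 0" by auto
    ultimately have "norm (R u) = \<rho>" using \<rho> by (simp add: R_def max_def)
    then show ?thesis using RM[OF that(1)] by (simp add: M_ball_def M_sphere_def)
  qed
  show thesis
  proof (rule that[of \<eta>])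
    have "continuous_on (M_ball Y \<rho>) (\<lambda>u. \<gamma> (R u))"
      by (rule continuous_on_compose2[OF c\<gamma> cR]) (use RM in \<open>auto simp: M_ball_def\<close>)
    then have "continuous_on (M_ball Y \<rho>) \<eta>"
      unfolding \<eta>_def by (intro continuous_intros cs cR continuous_on_compose2[OF g]) auto
    moreover have "\<eta> u = u" if "u \<in> M_sphere Y \<rho>" for u
      using that \<rho> by (simp add: \<eta>_def s_def R_def M_sphere_def)
    ultimately show "\<eta> \<in> Gamma_maps Y \<rho>" by (simp add: Gamma_maps_def)
    fix u assume u: "u \<in> M_ball Y \<rho>"
    show "(\<exists>v\<in>M_ball Y \<rho>. \<eta> u = g (\<gamma> v)) \<or>
       (\<exists>v\<in>M_sphere Y \<rho>. \<exists>s\<in>{0..1}. \<eta> u = (1 - s) *\<^sub>R g v + s *\<^sub>R v)"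
    proof (cases "s u > 0")
      case True
      have RS': "R u \<in> M_sphere Y \<rho>" using RS True u by (auto simp: M_ball_def)
      moreover have "s u \<in> {0..1}" using u \<rho> by (auto simp: s_def M_ball_def field_simps)
      ultimately show ?thesis by (intro disjI2 bexI[of _ "R u"] bexI[of _ "s u"]) (simp_all add: \<eta>_def id)
    next
      case False
      then have "s u = 0" by (auto simp: s_def)
      then show ?thesis using RM[of u] u by (intro disjI1 bexI[of _ "R u"]) (auto simp: \<eta>_def M_ball_def)
    qed
  qed
qed

text \<open>Here \<open>A\<close>, \<open>B\<close> are the values at a point \<open>v\<close>, and \<open>A'\<close>, \<open>B'\<close> those at its image under some
\<open>\<psi> n\<close>: the map raises the level \<open>A - B\<close> at most by the factor \<open>1 / \<beta>\<close>.\<close>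
lemma level_of_rescaled:
  fixes A A' B B' \<alpha> \<beta> :: real
  assumes "A' \<ge> 0" "\<beta> > 0" "\<beta> < \<alpha>" "\<alpha> * A' \<le> A" "B \<le> \<beta> * B'"
  shows "A' - B' \<le> (A - B) / \<beta>"
proof -
  have "\<beta> * A' \<le> \<alpha> * A'" using assms by (intro mult_right_mono) auto
  then have "\<beta> * (A' - B') \<le> A - B" using assms by (simp add: right_diff_distrib)
  then show ?thesis using assms(2) by (simp add: field_simps)
qed

text \<open>The monotonicity trick. Unless \<open>A'\<close> is small, the gap between \<open>\<alpha>\<close> and \<open>\<beta>\<close> makes the level drop
by about \<open>(\<alpha> - \<beta>) * A'\<close>. If the level does not start above \<open>c + (\<alpha> - \<beta>)\<close> nor end below \<open>c\<close>,
there is no room for such a drop.\<close>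
lemma rescaled_bound:
  fixes A A' B B' \<alpha> \<beta> c :: real
  assumes "\<beta> > 0" "\<beta> < \<alpha>" "\<alpha> * A' \<le> A" "B \<le> \<beta> * B'"
    and up: "A - B \<le> c + (\<alpha> - \<beta>)" and low: "c \<le> A' - B'"
  shows "A' \<le> \<bar>c\<bar> * (\<bar>1 - \<beta>\<bar> / (\<alpha> - \<beta>)) + 1"
proof -
  have "\<beta> * c \<le> \<beta> * (A' - B')" using assms by (intro mult_left_mono) auto
  then have "(\<alpha> - \<beta>) * A' \<le> c * (1 - \<beta>) + (\<alpha> - \<beta>)"
    using assms by (simp add: algebra_simps)
  also have "\<dots> \<le> \<bar>c\<bar> * \<bar>1 - \<beta>\<bar> + (\<alpha> - \<beta>)" by (simp flip: abs_mult)
  finally show ?thesis using \<open>\<beta> < \<alpha>\<close> by (simp add: field_simps)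
qed

lemma minimax_level_le_attained:
  fixes I :: "'a::real_normed_vector \<Rightarrow> real"
  assumes cI: "continuous_on UNIV I" and M: "compact (M_ball Y \<rho>)" "M_ball Y \<rho> \<noteq> {}"
    and \<gamma>: "\<gamma> \<in> Gamma_maps Y \<rho>"
  shows "\<exists>u\<in>M_ball Y \<rho>. minimax_level I Y \<rho> \<le> ereal (I (\<gamma> u))"
proof -
  have "continuous_on (M_ball Y \<rho>) (\<lambda>u. I (\<gamma> u))"
    using \<gamma> by (intro continuous_on_compose2[OF cI]) (auto simp: Gamma_maps_def)
  then obtain u where u: "u \<in> M_ball Y \<rho>" "\<And>v. v \<in> M_ball Y \<rho> \<Longrightarrow> I (\<gamma> v) \<le> I (\<gamma> u)"
    using continuous_attains_sup[OF M] by blast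
  have "minimax_level I Y \<rho> \<le> (SUP v\<in>\<gamma> ` M_ball Y \<rho>. ereal (I v))"
    unfolding minimax_level_def by (rule INF_lower[OF \<gamma>])
  also have "\<dots> \<le> ereal (I (\<gamma> u))" by (rule SUP_least) (use u in auto)
  finally show ?thesis using u(1) by blast
qed

section \<open>Almost critical sequences with bounded \<open>A\<close>\<close>

theorem theorem2p3:
  fixes I A B :: "'a::banach \<Rightarrow> real"
    and I' :: "'a \<Rightarrow> ('a \<Rightarrow>\<^sub>L real)"
    and \<psi> :: "nat \<Rightarrow> 'a \<Rightarrow> 'a"
    and Y Z :: "'a set"
    and \<rho> :: real
    and c :: ereal
  assumes deriv: "\<And>u. (I has_derivative blinfun_apply (I' u)) (at u)"
    and cont_deriv: "continuous_on UNIV I'"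
    and I_eq: "\<And>u. I u = A u - B u"
    and cond_A: "condition_A A"
    and cond_Psi: "condition_Psi A B \<psi>"
    and direct_sum: "topological_direct_sum Y Z"
    and fin_dim: "finite_dim_subspace Y"
    and rho_pos: "\<rho> > 0"
    and linking: "(INF u\<in>Z. ereal (I u)) > (SUP u\<in>M_sphere Y \<rho>. ereal (I u))"
    and psi_lim: "(\<lambda>n. SUP u\<in>M_sphere Y \<rho>. ennreal (norm (\<psi> n u - u))) \<longlonglongrightarrow> 0"
    and c_eq: "c = minimax_level I Y \<rho>"
  shows "\<exists>w :: nat \<Rightarrow> 'a.
           (\<lambda>n. ereal (I (w n))) \<longlonglongrightarrow> c \<and>
           (\<lambda>n. I' (w n)) \<longlonglongrightarrow> 0 \<and>
           (SUP n. ereal (A (w n))) < \<infinity>"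
proof -
  let ?M = "M_ball Y \<rho>" and ?N = "M_sphere Y \<rho>"
  have Y: "subspace Y" "closed Y" using direct_sum by (auto simp: topological_direct_sum_def)
  have cI: "continuous_on UNIV I"
    using deriv by (meson continuous_at_imp_continuous_on has_derivative_continuous)
  have M: "compact ?M" by (rule compact_M_ball[OF fin_dim Y(2)])
  have M0: "?M \<noteq> {}" using Y rho_pos by (auto simp: M_ball_def subspace_0 intro!: exI[of _ 0])
  have NM: "?N \<subseteq> ?M" by (auto simp: M_sphere_def M_ball_def)
  have "?N = Y \<inter> {u. norm u = \<rho>}" by (auto simp: M_sphere_def)
  moreover have "closed {u :: 'a. norm u = \<rho>}" by (intro closed_Collect_eq continuous_intros)
  ultimately have N: "closed ?N" using closed_Int[OF Y(2)] by simp
  then have Nc: "compact ?N" using M NM compact_Int_closed[of ?M ?N] by (simp add: inf_absorb2)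
  note attained = minimax_level_le_attained[OF cI M M0, folded c_eq]

  \<comment> \<open>The linking property and the level of the identity path make \<open>c\<close> a real number above the values on the sphere.\<close>
  have c_lower: "(INF u\<in>Z. ereal (I u)) \<le> c"
    unfolding c_eq minimax_level_def
  proof (rule INF_greatest)
    fix \<gamma> assume \<gamma>: "\<gamma> \<in> Gamma_maps Y \<rho>"
    obtain u where u: "u \<in> ?M" "\<gamma> u \<in> Z"
      using linking_intersection[OF direct_sum fin_dim rho_pos \<gamma>] by blast
    have "(INF u\<in>Z. ereal (I u)) \<le> ereal (I (\<gamma> u))" by (rule INF_lower[OF u(2)])
    also have "\<dots> \<le> (SUP u\<in>\<gamma> ` ?M. ereal (I u))" by (rule SUP_upper) (use u in auto)
    finally show "(INF u\<in>Z. ereal (I u)) \<le> (SUP u\<in>\<gamma> ` ?M. ereal (I u))" .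
  qed
  have sup_N: "(SUP u\<in>?N. ereal (I u)) < c" using linking c_lower by (rule less_le_trans)
  have "(\<lambda>u. u) \<in> Gamma_maps Y \<rho>" by (simp add: Gamma_maps_def)
  from attained[OF this] have "c \<noteq> \<infinity>" by auto
  moreover have "c \<noteq> - \<infinity>" using sup_N by auto
  ultimately obtain c0 where c0: "c = ereal c0" by (cases c) auto
  obtain \<sigma> where \<sigma>0: "(SUP u\<in>?N. ereal (I u)) < ereal \<sigma>" and \<sigma>: "\<sigma> < c0"
    using ereal_dense2[OF sup_N] c0 by auto
  have \<sigma>N: "I u \<le> \<sigma>" if "u \<in> ?N" for u
  proof -
    have "ereal (I u) \<le> (SUP u\<in>?N. ereal (I u))" using that by (rule SUP_upper)
    also note \<sigma>0
    finally show ?thesis by simp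
  qed
  \<comment> \<open>The level \<open>c0\<close> is not reached within distance \<open>d\<close> of the sphere, hence not on a narrow collar.\<close>
  obtain d where d: "d > 0" "\<And>x y. x \<in> ?N \<Longrightarrow> dist x y < d \<Longrightarrow> dist (I x) (I y) < c0 - \<sigma>"
    using uniformly_continuous_near_compact[OF Nc cI, of "c0 - \<sigma>"] \<sigma> by auto
  have near_N: "I y < c0" if "x \<in> ?N" "dist x y < d" for x y
    using d(2)[OF that] \<sigma>N[OF that(1)] by (simp add: dist_real_def)

  have \<psi>: "\<And>n. continuous_on UNIV (\<psi> n)" using cond_Psi by (simp add: condition_Psi_def)
  obtain \<alpha> \<beta> :: "nat \<Rightarrow> real" where ab: "\<And>n. \<beta> n < \<alpha> n" "\<And>n. 0 < \<beta> n"
    and abA: "\<And>n u. \<alpha> n * A (\<psi> n u) \<le> A u" and abB: "\<And>n u. B u \<le> \<beta> n * B (\<psi> n u)"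
    and lims: "\<alpha> \<longlonglongrightarrow> 1" "\<beta> \<longlonglongrightarrow> 1"
    and limi: "liminf (\<lambda>n. ereal (\<bar>1 - \<beta> n\<bar> / (\<alpha> n - \<beta> n))) < \<infinity>"
  proof -
    have "\<exists>\<alpha> \<beta> :: nat \<Rightarrow> real. (\<forall>n. \<alpha> n > \<beta> n \<and> \<beta> n > 0) \<and>
        (\<forall>n u. A u \<ge> \<alpha> n * A (\<psi> n u) \<and> B u \<le> \<beta> n * B (\<psi> n u)) \<and> \<alpha> \<longlonglongrightarrow> 1 \<and> \<beta> \<longlonglongrightarrow> 1 \<and>
        liminf (\<lambda>n. ereal (\<bar>1 - \<beta> n\<bar> / (\<alpha> n - \<beta> n))) < \<infinity>"
      using cond_Psi unfolding condition_Psi_def by (rule conjunct2)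
    then show ?thesis by (elim exE conjE, intro that) simp_all
  qed
  have A0: "A u \<ge> 0" for u using cond_A by (simp add: condition_A_def)
  obtain L where L: "liminf (\<lambda>n. ereal (\<bar>1 - \<beta> n\<bar> / (\<alpha> n - \<beta> n))) < ereal L"
    using ereal_dense2[OF limi] by blast
  have freq: "\<exists>\<^sub>F n in sequentially. \<bar>1 - \<beta> n\<bar> / (\<alpha> n - \<beta> n) < L"
  proof (rule ccontr)
    assume "\<not> ?thesis"
    then have "\<forall>\<^sub>F n in sequentially. ereal L \<le> ereal (\<bar>1 - \<beta> n\<bar> / (\<alpha> n - \<beta> n))"
      by (simp add: not_frequently not_less)
    then have "ereal L \<le> liminf (\<lambda>n. ereal (\<bar>1 - \<beta> n\<bar> / (\<alpha> n - \<beta> n)))"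
      by (rule Liminf_bounded)
    then show False using L by simp
  qed
  \<comment> \<open>The bound that \<open>rescaled_bound\<close> gives for infinitely many \<open>n\<close>.\<close>
  define K where "K = \<bar>c0\<bar> * \<bar>L\<bar> + 1"
  have K: "K > 0" by (simp add: K_def add_nonneg_pos)
  obtain \<delta>0 where \<delta>0: "\<delta>0 > 0" "\<And>u. edist_set u (sublevel A K) \<le> ereal \<delta>0 \<Longrightarrow> u \<in> sublevel A (K + 1)"
  proof -
    have "\<exists>\<delta>>0. \<forall>u. edist_set u (sublevel A K) \<le> ereal \<delta> \<longrightarrow> u \<in> sublevel A (K + 1)"
      using cond_A K unfolding condition_A_def by simp
    then show ?thesis using that by blast
  qed
  define \<delta> where "\<delta> = min \<delta>0 1"
  have \<delta>: "0 < \<delta>" "\<delta> \<le> \<delta>0" "\<delta> \<le> 1" using \<delta>0(1) by (auto simp: \<delta>_def)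
  obtain r where r: "continuous_on UNIV r" "range r \<subseteq> ?M" "\<And>u. u \<in> ?M \<Longrightarrow> r u = u"
  proof (rule M_ball_retraction[OF direct_sum rho_pos], goal_cases)
    case (1 r)
    show ?thesis by (rule 1(1)[OF 1(2-4)])
  qed

  have approx: "\<exists>w. \<bar>I w - c0\<bar> \<le> e \<and> norm (I' w) \<le> e \<and> A w \<le> K + 1" if e: "e > 0" for e
  proof -
    \<comment> \<open>The tolerances of the minimax principle: it yields \<open>norm (I' w) \<le> 4 * \<kappa> = e\<close>.\<close>
    define \<kappa> where "\<kappa> = e / 4"
    have \<kappa>: "\<kappa> > 0" using e by (simp add: \<kappa>_def)
    have "(\<lambda>n. (c0 + (\<alpha> n - \<beta> n)) / \<beta> n) \<longlonglongrightarrow> (c0 + (1 - 1)) / 1"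
      by (intro tendsto_intros lims) auto
    then have ev1: "\<forall>\<^sub>F n in sequentially. (c0 + (\<alpha> n - \<beta> n)) / \<beta> n < c0 + \<kappa> * \<delta>"
      using \<kappa> \<delta> by (intro order_tendstoD(2)) auto
    have ev2: "\<forall>\<^sub>F n in sequentially. (SUP u\<in>?N. ennreal (norm (\<psi> n u - u))) < ennreal d"
      using psi_lim d(1) by (intro order_tendstoD(2)) auto
    obtain n where n: "\<bar>1 - \<beta> n\<bar> / (\<alpha> n - \<beta> n) < L" "(c0 + (\<alpha> n - \<beta> n)) / \<beta> n < c0 + \<kappa> * \<delta>"
      "(SUP u\<in>?N. ennreal (norm (\<psi> n u - u))) < ennreal d"
      using frequently_ex[OF frequently_eventually_frequently[OF freq eventually_conj[OF ev1 ev2]]] by blast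
    have \<psi>N: "norm (\<psi> n u - u) < d" if "u \<in> ?N" for u
    proof -
      have "ennreal (norm (\<psi> n u - u)) < ennreal d" using n(3) SUP_upper[OF that] by (rule le_less_trans[rotated])
      then show ?thesis by (simp add: ennreal_less_iff)
    qed
    \<comment> \<open>The slack \<open>\<alpha> n - \<beta> n\<close> tends to \<open>0\<close>, and it stays bounded after the division by \<open>\<alpha> n - \<beta> n\<close> in \<open>rescaled_bound\<close>.\<close>
    have "minimax_level I Y \<rho> < ereal (c0 + (\<alpha> n - \<beta> n))" unfolding c_eq[symmetric] c0 using ab(1)[of n] by simp
    then obtain \<gamma> where \<gamma>: "\<gamma> \<in> Gamma_maps Y \<rho>"
      and \<gamma>0: "(SUP u\<in>\<gamma> ` ?M. ereal (I u)) < ereal (c0 + (\<alpha> n - \<beta> n))"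
      unfolding minimax_level_def by (auto simp: INF_less_iff)
    have \<gamma>up: "I (\<gamma> v) \<le> c0 + (\<alpha> n - \<beta> n)" if "v \<in> ?M" for v
    proof -
      have "ereal (I (\<gamma> v)) \<le> (SUP u\<in>\<gamma> ` ?M. ereal (I u))" using that by (intro SUP_upper imageI)
      also note \<gamma>0
      finally show ?thesis by simp
    qed
    obtain \<eta> where \<eta>: "\<eta> \<in> Gamma_maps Y \<rho>"
      and \<eta>_cases: "\<And>u. u \<in> ?M \<Longrightarrow> (\<exists>v\<in>?M. \<eta> u = \<psi> n (\<gamma> v)) \<or>
         (\<exists>v\<in>?N. \<exists>s\<in>{0..1}. \<eta> u = (1 - s) *\<^sub>R \<psi> n v + s *\<^sub>R v)"
    proof (rule collared_path[OF Y(1) rho_pos \<gamma> \<psi>[of n]], goal_cases)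
      case (1 \<eta>)
      show ?thesis by (rule 1(1)[OF 1(2-3)])
    qed
    have collar: "I ((1 - s) *\<^sub>R \<psi> n v + s *\<^sub>R v) < c0" if "v \<in> ?N" "s \<in> {0..1}" for v s
    proof (rule near_N[OF that(1)])
      have "v - ((1 - s) *\<^sub>R \<psi> n v + s *\<^sub>R v) = - ((1 - s) *\<^sub>R (\<psi> n v - v))"
        by (simp add: algebra_simps)
      then have "dist v ((1 - s) *\<^sub>R \<psi> n v + s *\<^sub>R v) = (1 - s) * norm (\<psi> n v - v)"
        using that(2) by (simp add: dist_norm)
      also have "\<dots> \<le> norm (\<psi> n v - v)" using that(2) by (simp add: mult_left_le_one_le)
      also have "\<dots> < d" by (rule \<psi>N[OF that(1)])
      finally show "dist v ((1 - s) *\<^sub>R \<psi> n v + s *\<^sub>R v) < d" .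
    qed
    have \<eta>up: "I (\<eta> u) \<le> c0 + \<kappa> * \<delta>" if u: "u \<in> ?M" for u
      using \<eta>_cases[OF u]
    proof (elim disjE bexE)
      fix v assume v: "v \<in> ?M" "\<eta> u = \<psi> n (\<gamma> v)"
      have "I (\<psi> n (\<gamma> v)) \<le> I (\<gamma> v) / \<beta> n"
        unfolding I_eq by (rule level_of_rescaled[OF A0 ab(2) ab(1) abA abB])
      also have "\<dots> \<le> (c0 + (\<alpha> n - \<beta> n)) / \<beta> n"
        using \<gamma>up[OF v(1)] ab(2)[of n] by (simp add: divide_right_mono)
      finally show ?thesis using n(2) v(2) by simp
    next
      fix v s assume "v \<in> ?N" "s \<in> {0..1}" "\<eta> u = (1 - s) *\<^sub>R \<psi> n v + s *\<^sub>R v"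
      with collar[of v s] show ?thesis using mult_pos_pos[OF \<kappa> \<delta>(1)] by simp
    qed
    \<comment> \<open>Points at level \<open>c0\<close> or above do not lie on the collar, so they come from \<open>\<psi> n\<close>.\<close>
    have \<eta>A: "A (\<eta> u) \<le> K" if u: "u \<in> ?M" "c0 \<le> I (\<eta> u)" for u
    proof -
      obtain v where v: "v \<in> ?M" "\<eta> u = \<psi> n (\<gamma> v)"
        using \<eta>_cases[OF u(1)] collar u(2) by fastforce
      have "A (\<psi> n (\<gamma> v)) \<le> \<bar>c0\<bar> * (\<bar>1 - \<beta> n\<bar> / (\<alpha> n - \<beta> n)) + 1"
        by (rule rescaled_bound[OF ab(2) ab(1) abA abB \<gamma>up[OF v(1), unfolded I_eq]])
          (use u(2) v(2) I_eq in simp)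
      also have "\<dots> \<le> \<bar>c0\<bar> * \<bar>L\<bar> + 1" using n(1) by (intro add_mono mult_left_mono) auto
      finally show ?thesis using v(2) by (simp add: K_def)
    qed
    have \<eta>c: "continuous_on ?M \<eta>" and \<eta>id: "\<And>u. u \<in> ?N \<Longrightarrow> \<eta> u = u"
      using \<eta> by (auto simp: Gamma_maps_def)
    have \<eta>N: "I (\<eta> u) < c0" if "u \<in> ?N" for u using \<sigma>N[OF that] \<sigma> \<eta>id[OF that] by simp
    have link: "\<exists>u\<in>?M. c0 \<le> I (\<gamma>' u)" if "continuous_on ?M \<gamma>'" "\<forall>u\<in>?N. \<gamma>' u = \<eta> u" for \<gamma>'
      using attained[of \<gamma>'] that \<eta>id c0 by (auto simp: Gamma_maps_def)
    obtain u w where u: "u \<in> ?M" and w: "c0 \<le> I w" "I w \<le> I (\<eta> u)" "norm (w - \<eta> u) \<le> \<delta>"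
      "norm (I' w) \<le> 4 * \<kappa>"
    by (rule constrained_minimax_principle[OF deriv cont_deriv M M0 r N NM \<eta>N \<eta>c \<eta>up \<kappa> link])
    have "A (\<eta> u) \<le> K" by (rule \<eta>A[OF u]) (use w in simp)
    then have "edist_set w (sublevel A K) \<le> ereal (norm (w - \<eta> u))"
      unfolding edist_set_def by (intro INF_lower) (simp add: sublevel_def)
    also have "\<dots> \<le> ereal \<delta>0" using w(3) \<delta>(2) by simp
    finally have "A w \<le> K + 1" using \<delta>0(2) by (auto simp: sublevel_def)
    moreover have "\<kappa> * \<delta> \<le> e" using \<delta> e mult_left_le[of \<delta> \<kappa>] by (simp add: \<kappa>_def)
    ultimately show ?thesis
      using w(1,2,4) \<eta>up[OF u] by (intro exI[of _ w]) (simp add: \<kappa>_def)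
  qed
  then have "\<forall>k. \<exists>w. \<bar>I w - c0\<bar> \<le> inverse (real (Suc k)) \<and> norm (I' w) \<le> inverse (real (Suc k)) \<and> A w \<le> K + 1"
    by simp
  then obtain w where w: "\<And>k. \<bar>I (w k) - c0\<bar> \<le> inverse (real (Suc k))"
    "\<And>k. norm (I' (w k)) \<le> inverse (real (Suc k))" "\<And>k. A (w k) \<le> K + 1" by metis
  have "(\<lambda>k. I (w k)) \<longlonglongrightarrow> c0"
    by (rule metric_tendsto_imp_tendsto[OF LIMSEQ_inverse_real_of_nat])
      (use w(1) in \<open>simp add: dist_real_def\<close>)
  then have "(\<lambda>k. ereal (I (w k))) \<longlonglongrightarrow> c" by (simp add: c0)
  moreover have "(\<lambda>k. I' (w k)) \<longlonglongrightarrow> 0"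
    by (rule metric_tendsto_imp_tendsto[OF LIMSEQ_inverse_real_of_nat]) (use w(2) in simp)
  moreover have "(SUP k. ereal (A (w k))) \<le> ereal (K + 1)"
    by (rule SUP_least) (use w(3) in simp)
  then have "(SUP k. ereal (A (w k))) < \<infinity>" using le_less_trans by fastforce
  ultimately show ?thesis by blast
qed

end
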